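(* Let $n=2l+1$ be odd and let $U=(u_1,\dots,u_n):\mathbb{R}^2\to\mathbb{R}^n$, $(t,x)\mapsto U(t,x)$, be a $C^2$ solution, periodic in $t$ and in $x$, of the quasi-linear system $U_t+A(U)U_x=0$. Assume that for every $(t,x)$ the matrix $A(U(t,x))$ has one real eigenvalue and $l$ complex conjugate pairs of non-real eigenvalues (counted with multiplicity). Assume moreover that the characteristic polynomial of $A(U)$ can be continuously factorized: $$F_p(p,x,t)=\bigl(p-\mu(t,x)\bigr)\prod_{i=1}^{l}\bigl(p-\lambda_i(t,x)\bigr)\bigl(p-\overline{\lambda_i(t,x)}\bigr),$$ where $\mu,\lambda_1,\dots,\lambda_l$ are continuous functions of $(t,x)$, $\mu$ is real valued and the $\lambda_i$ are non-real valued. Then the functions $u_1,\dots,u_n$ do not depend on $t$.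
   Context: The system $U_t+A(U)U_x=0$ is, written in components with the conventions $u_0=0$ and $u_{n+1}=0$, $$(u_k)_t+(u_{k+1})_x-(n+1-k)\,u_{k-1}\,(u_1)_x=0,\qquad k=1,\dots,n,$$ i.e. $A(U)$ is the $n\times n$ matrix with entries $1$ on the superdiagonal, first column $(0,-(n-1)u_1,-(n-2)u_2,\dots,-2u_{n-2},-u_{n-1})^t$, and all other entries $0$. Put $F(p,x,t)=\frac{1}{n+1}p^{n+1}+u_1(t,x)p^{n-1}+u_2(t,x)p^{n-2}+\dots+u_n(t,x)$; the characteristic polynomial of $A(U(t,x))$ is $F_p=\partial F/\partial p=p^n+(n-1)u_1p^{n-2}+\dots+2u_{n-2}p+u_{n-1}$. Periodic means periodic separately in $t$ and in $x$, with some positive periods. The functions $\mu,\lambda_i$ are continuous functions on $\mathbb{R}^2$; the individual $\lambda_i$ are not required to be periodic. Several $\lambda_i$ may coincide at some points. *)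

theory Defs
  imports "HOL-Analysis.Analysis" "Jordan_Normal_Form.Char_Poly"
begin

text \<open>
  Points of the plane are pairs \<open>(t, x)\<close>. The unknown \<open>U = (u\<^sub>1, \<dots>, u\<^sub>n)\<close> is a family
  \<open>u :: nat \<Rightarrow> real \<times> real \<Rightarrow> real\<close> of which only the members \<open>u 1, \<dots>, u n\<close> matter: since
  \<open>n\<close> varies with \<open>l\<close>, it is a term and not a type.
\<close>

definition partial_t :: "(real \<times> real \<Rightarrow> real) \<Rightarrow> real \<times> real \<Rightarrow> real" where
  "partial_t f z = deriv (\<lambda>s. f (s, snd z)) (fst z)"

definition partial_x :: "(real \<times> real \<Rightarrow> real) \<Rightarrow> real \<times> real \<Rightarrow> real" where
  "partial_x f z = deriv (\<lambda>y. f (fst z, y)) (snd z)"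

fun C_k :: "nat \<Rightarrow> (real \<times> real \<Rightarrow> real) \<Rightarrow> bool" where
  "C_k 0 f \<longleftrightarrow> continuous_on UNIV f"
| "C_k (Suc k) f \<longleftrightarrow> f differentiable_on UNIV \<and> C_k k (partial_t f) \<and> C_k k (partial_x f)"

definition periodic_t :: "nat \<Rightarrow> (nat \<Rightarrow> real \<times> real \<Rightarrow> real) \<Rightarrow> bool" where
  "periodic_t n u \<longleftrightarrow> (\<exists>T>0. \<forall>k\<in>{1..n}. \<forall>t x. u k (t + T, x) = u k (t, x))"

definition periodic_x :: "nat \<Rightarrow> (nat \<Rightarrow> real \<times> real \<Rightarrow> real) \<Rightarrow> bool" where
  "periodic_x n u \<longleftrightarrow> (\<exists>X>0. \<forall>k\<in>{1..n}. \<forall>t x. u k (t, x + X) = u k (t, x))"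

text \<open>
  Matrices are indexed from \<open>0\<close>, so position \<open>(i, j)\<close> is row \<open>i + 1\<close> and column \<open>j + 1\<close> of
  \<open>A(U)\<close>. The first column is \<open>(0, -(n-1) u\<^sub>1, -(n-2) u\<^sub>2, \<dots>, -2 u\<^sub>n\<^sub>-\<^sub>2, -u\<^sub>n\<^sub>-\<^sub>1)\<close>.
\<close>

definition sys_mat :: "nat \<Rightarrow> (nat \<Rightarrow> real) \<Rightarrow> real mat" where
  "sys_mat n v = mat n n (\<lambda>(i, j).
     if j = i + 1 then 1
     else if j = 0 \<and> 1 \<le> i then - (real n - real i) * v i
     else 0)"

definition solves_system :: "nat \<Rightarrow> (nat \<Rightarrow> real \<times> real \<Rightarrow> real) \<Rightarrow> bool" where
  "solves_system n u \<longleftrightarrow> (\<forall>z.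
     Matrix.vec n (\<lambda>i. partial_t (u (i + 1)) z)
       + sys_mat n (\<lambda>k. u k z) *\<^sub>v Matrix.vec n (\<lambda>i. partial_x (u (i + 1)) z) = 0\<^sub>v n)"

lemma solves_system_components:
  "solves_system n u \<longleftrightarrow> (\<forall>z. \<forall>k\<in>{1..n}.
     partial_t (u k) z
       + (if k = n then 0 else partial_x (u (k + 1)) z)
       - (real n + 1 - real k) * (if k = 1 then 0 else u (k - 1) z) * partial_x (u 1) z = 0)"
proof -
  have row: "(sys_mat n v *\<^sub>v Matrix.vec n w) $ i =
      (if i + 1 = n then 0 else w (i + 1)) - (real n - real i) * (if i = 0 then 0 else v i) * w 0"
    if i: "i < n" for i v and w :: "nat \<Rightarrow> real"
  proof -
    have "(sys_mat n v *\<^sub>v Matrix.vec n w) $ i =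
        (\<Sum>j = 0..<n. (if j = i + 1 then w j else 0)
          + (if j = 0 then (if i = 0 then 0 else - (real n - real i) * v i * w j) else 0))"
      using i by (auto simp: sys_mat_def scalar_prod_def intro!: sum.cong)
    also have "\<dots> = (if i + 1 = n then 0 else w (i + 1))
        - (real n - real i) * (if i = 0 then 0 else v i) * w 0"
      using i by (auto simp: sum.distrib sum.delta algebra_simps)
    finally show ?thesis .
  qed
  have dim: "dim_row (sys_mat n v) = n" for v
    by (simp add: sys_mat_def)
  have shift: "(\<forall>k\<in>{1..n}. P k) \<longleftrightarrow> (\<forall>i<n. P (i + 1))" for P
    by (metis One_nat_def Suc_eq_plus1 Suc_le_D Suc_le_eq atLeastAtMost_iff le_add2)
  show ?thesis
    unfolding solves_system_def shift vec_eq_iff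
    by (auto simp: row dim add_ac diff_add_eq algebra_simps simp del: index_mult_mat_vec)
qed

text \<open>
  The polynomial \<open>F(p) = p^(n+1) / (n+1) + u\<^sub>1 p^(n-1) + \<dots> + u\<^sub>n\<close> in the variable \<open>p\<close>.
\<close>

definition F_poly :: "nat \<Rightarrow> (nat \<Rightarrow> real) \<Rightarrow> real poly" where
  "F_poly n v = Polynomial.monom (1 / (real n + 1)) (n + 1)
     + (\<Sum>k = 1..n. Polynomial.monom (v k) (n - k))"

lemma det_first_column_superdiagonal:
  fixes c :: "nat \<Rightarrow> real"
  assumes "0 < m"
  shows "Determinant.det (mat m m (\<lambda>(i, j). if j = i then [:0, 1:] else if j = i + 1 then -1
            else if j = 0 then [:c i:] else 0))
    = Polynomial.monom 1 m + (\<Sum>k = 1..<m. Polynomial.monom (c k) (m - 1 - k))"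
  using assms
proof (induction m)
  case (Suc m)
  define B :: "nat \<Rightarrow> real poly mat" where
    "B m = mat m m (\<lambda>(i, j). if j = i then [:0, 1:] else if j = i + 1 then -1
            else if j = 0 then [:c i:] else 0)" for m
  show ?case
  proof (cases "m = 0")
    case True
    then show ?thesis
      by (subst det_single) (auto simp: monom_altdef)
  next
    case False
    have car: "B (Suc m) \<in> carrier_mat (Suc m) (Suc m)"
      by (simp add: B_def)
    have minor_last: "mat_delete (B (Suc m)) m m = B m"
      by (rule eq_matI) (auto simp: B_def mat_delete_def)
    have minor_first: "Determinant.det (mat_delete (B (Suc m)) m 0) = (-1) ^ m"
    proof (subst det_lower_triangular)
      show "mat_delete (B (Suc m)) m 0 \<in> carrier_mat m m"
        by (simp add: B_def mat_delete_def)
      show "prod_list (diag_mat (mat_delete (B (Suc m)) m 0)) = (-1) ^ m"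
        by (simp add: prod_list_diag_prod B_def mat_delete_def)
    qed (auto simp: B_def mat_delete_def)
    have "Determinant.det (B (Suc m)) =
        (\<Sum>j<Suc m. B (Suc m) $$ (m, j) * cofactor (B (Suc m)) m j)"
      by (rule laplace_expansion_row[OF car]) simp
    also have "\<dots> = (\<Sum>j\<in>{0, m}. B (Suc m) $$ (m, j) * cofactor (B (Suc m)) m j)"
      by (rule sum.mono_neutral_right) (auto simp: B_def)
    also have "\<dots> = [:c m:] + [:0, 1:] * Determinant.det (B m)"
      using False
      by (simp add: cofactor_def minor_first minor_last flip: power_add)
         (simp add: B_def)
    also have "Determinant.det (B m) =
        Polynomial.monom 1 m + (\<Sum>k = 1..<m. Polynomial.monom (c k) (m - 1 - k))"
      using Suc.IH False by (simp add: B_def)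
    also have "[:c m:] + [:0, 1:] * (Polynomial.monom 1 m
          + (\<Sum>k = 1..<m. Polynomial.monom (c k) (m - 1 - k)))
        = Polynomial.monom 1 (Suc m) + (\<Sum>k = 1..<Suc m. Polynomial.monom (c k) (Suc m - 1 - k))"
    proof -
      have "[:0, 1:] * (\<Sum>k = 1..<m. Polynomial.monom (c k) (m - 1 - k))
          = (\<Sum>k = 1..<m. Polynomial.monom (c k) (m - k))"
        unfolding sum_distrib_left
        by (rule sum.cong) (auto simp: monom_Suc[symmetric] Suc_diff_Suc)
      then show ?thesis
        using False by (simp add: distrib_left monom_Suc monom_0)
    qed
    finally show ?thesis
      by (simp add: B_def)
  qed
qed simp

lemma char_poly_sys_mat:
  assumes "0 < n"
  shows "char_poly (sys_mat n v) = pderiv (F_poly n v)"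
proof -
  have "char_poly_matrix (sys_mat n v) = mat n n (\<lambda>(i, j). if j = i then [:0, 1:]
      else if j = i + 1 then -1 else if j = 0 then [:(real n - real i) * v i:] else 0)"
    by (rule eq_matI) (auto simp: char_poly_matrix_def sys_mat_def one_pCons algebra_simps)
  then have "char_poly (sys_mat n v) = Polynomial.monom 1 n
      + (\<Sum>k = 1..<n. Polynomial.monom ((real n - real k) * v k) (n - 1 - k))"
    unfolding char_poly_def using det_first_column_superdiagonal[OF assms] by simp
  also have "\<dots> = pderiv (F_poly n v)"
  proof -
    have "(\<Sum>k = 1..n. Polynomial.monom (real (n - k) * v k) (n - k - 1))
        = (\<Sum>k = 1..<n. Polynomial.monom ((real n - real k) * v k) (n - 1 - k))"
      by (rule sum.mono_neutral_cong_right) (auto simp: of_nat_diff diff_right_commute)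
    then show ?thesis
      by (simp add: F_poly_def pderiv_add pderiv_sum pderiv_monom add.commute)
  qed
  finally show ?thesis .
qed

definition complex_eigenvalues :: "real mat \<Rightarrow> complex multiset" where
  "complex_eigenvalues A = proots (char_poly (map_mat complex_of_real A))"

definition one_real_rest_conjugate_pairs :: "nat \<Rightarrow> real mat \<Rightarrow> bool" where
  "one_real_rest_conjugate_pairs l A \<longleftrightarrow> (\<exists>r Z.
     complex_eigenvalues A = {#complex_of_real r#} + Z + image_mset cnj Z
       \<and> size Z = l \<and> (\<forall>z\<in>#Z. z \<notin> \<real>))"

end

theory Submission
  imports Defs
begin

text \<open>
  The system says \<open>F\<^sub>t + p F\<^sub>x = (u\<^sub>1)\<^sub>x F\<^sub>p\<close>. Hence the critical values \<open>r\<^sub>i = F(\<lambda>\<^sub>i)\<close>, which are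
  \<open>C\<^sup>1\<close> even where roots collide, satisfy \<open>(r\<^sub>i)\<^sub>t + \<lambda>\<^sub>i (r\<^sub>i)\<^sub>x = 0\<close>. With all \<open>\<lambda>\<^sub>i\<close> taken in the
  upper half plane, the exact form \<open>d (\<Sum> Re r\<^sub>i d Im r\<^sub>i)\<close> is the derivative of a periodic form
  and has density \<open>\<Sum> Im \<lambda>\<^sub>i |(r\<^sub>i)\<^sub>x|\<^sup>2\<close>, so all \<open>r\<^sub>i\<close> are constant. Therefore \<open>F\<^sub>x\<close> and
  \<open>F\<^sub>t\<close> are divisible by \<open>F\<^sub>p / (p - \<mu>)\<close>, that is \<open>(p - \<mu>) F\<^sub>x = (u\<^sub>1)\<^sub>x F\<^sub>p\<close> and
  \<open>F\<^sub>t = - \<mu> F\<^sub>x\<close>. The second equation makes \<open>\<mu>\<close> constant along straight lines of slope \<open>\<mu>\<close>,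
  hence constant, and the first one forces \<open>F\<^sub>x = 0\<close> if this constant is not \<open>0\<close>.
\<close>

subsection \<open>Polynomials and their roots\<close>

lemma poly_eq_sum_atMost:
  fixes p :: "'a :: comm_semiring_1 poly"
  assumes "Polynomial.degree p \<le> N"
  shows "poly p x = (\<Sum>i\<le>N. Polynomial.coeff p i * x ^ i)"
  unfolding poly_altdef
  by (rule sum.mono_neutral_left) (use assms in \<open>auto simp: coeff_eq_0\<close>)

lemma order_prod_linear_factors:
  fixes \<rho> :: "'k \<Rightarrow> 'a :: idom"
  assumes "finite K"
  shows "Polynomial.order a (\<Prod>k\<in>K. [:- \<rho> k, 1:]) = card {k \<in> K. \<rho> k = a}"
  using assms
proof induction
  case (insert k K)
  have nz: "(\<Prod>k\<in>insert k K. [:- \<rho> k, 1:]) \<noteq> 0"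
    using insert.hyps by (subst prod_zero_iff) auto
  have "Polynomial.order a [:- \<rho> k, 1:] = (if \<rho> k = a then 1 else 0)"
    using order_power_n_n[of a 1] by (auto intro!: order_0I)
  moreover have "{j \<in> insert k K. \<rho> j = a} = (if \<rho> k = a then insert k {j \<in> K. \<rho> j = a} else {j \<in> K. \<rho> j = a})"
    by auto
  moreover have "Polynomial.order a (\<Prod>k\<in>insert k K. [:- \<rho> k, 1:])
      = Polynomial.order a [:- \<rho> k, 1:] + Polynomial.order a (\<Prod>k\<in>K. [:- \<rho> k, 1:])"
    using nz unfolding prod.insert[OF insert.hyps] by (rule order_mult)
  ultimately show ?case
    using insert.IH insert.hyps by simp
qed simp

text \<open>Induction on \<open>K\<close>: the order hypothesis at \<open>\<rho> k\<close> lets the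
  factor of \<open>k\<close> be split off. The quotient loses exactly one from its order at that
  point and nothing elsewhere, just as removing \<open>k\<close> changes the counts.\<close>

lemma prod_linear_factors_dvd:
  fixes \<rho> :: "'k \<Rightarrow> 'a :: idom"
  assumes "finite K" "p \<noteq> 0" "\<And>a. card {k \<in> K. \<rho> k = a} \<le> Polynomial.order a p"
  shows "(\<Prod>k\<in>K. [:- \<rho> k, 1:]) dvd p"
  using assms
proof (induction arbitrary: p)
  case (insert k K)
  have "card {j \<in> insert k K. \<rho> j = \<rho> k} > 0"
    using insert by (auto simp: card_gt_0_iff)
  then have "Polynomial.order (\<rho> k) p \<noteq> 0"
    using insert.prems(2)[of "\<rho> k"] by linarith
  then have "[:- \<rho> k, 1:] dvd p"
    by (simp add: order_root poly_eq_0_iff_dvd[symmetric])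
  then obtain q where q: "p = [:- \<rho> k, 1:] * q"
    by blast
  have "card {j \<in> K. \<rho> j = a} \<le> Polynomial.order a q" for a
  proof -
    have "Polynomial.order a p = Polynomial.order a [:- \<rho> k, 1:] + Polynomial.order a q"
      using insert.prems(1) unfolding q by (rule order_mult)
    moreover have "Polynomial.order a [:- \<rho> k, 1:] = (if \<rho> k = a then 1 else 0)"
      using order_power_n_n[of a 1] by (auto intro!: order_0I)
    moreover have "{j \<in> insert k K. \<rho> j = a}
        = (if \<rho> k = a then insert k {j \<in> K. \<rho> j = a} else {j \<in> K. \<rho> j = a})"
      by auto
    ultimately show ?thesis
      using insert.prems(2)[of a] insert.hyps by (auto split: if_splits)
  qed
  moreover have "q \<noteq> 0"
    using insert.prems q by auto
  ultimately have "(\<Prod>k\<in>K. [:- \<rho> k, 1:]) dvd q"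
    using insert.IH by blast
  then show ?case
    using insert.hyps q by (simp del: mult_pCons_left)
qed simp

text \<open>In characteristic zero each differentiation lowers the order of a root by exactly
  one.\<close>

lemma higher_pderiv_at_root:
  fixes p :: "'a :: field_char_0 poly"
  assumes "p \<noteq> 0" "Polynomial.order a p = m"
  shows "(\<forall>j<m. poly ((pderiv ^^ j) p) a = 0) \<and> poly ((pderiv ^^ m) p) a \<noteq> 0"
  using assms
proof (induction m arbitrary: p)
  case 0
  then show ?case by (simp add: order_root)
next
  case (Suc m)
  have root: "poly p a = 0"
    using Suc.prems by (simp add: order_root)
  have nz: "pderiv p \<noteq> 0"
  proof
    assume "pderiv p = 0"
    then obtain c where "p = [:c:]"
      by (metis degree_eq_zeroE pderiv_eq_0_iff)
    then show False using root Suc.prems(1) by simp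
  qed
  then have "Polynomial.order a (pderiv p) = m"
    using order_pderiv[OF Suc.prems(1) root] Suc.prems(2) by simp
  then have IH: "(\<forall>j<m. poly ((pderiv ^^ j) (pderiv p)) a = 0) \<and> poly ((pderiv ^^ m) (pderiv p)) a \<noteq> 0"
    by (rule Suc.IH[OF nz])
  have "(pderiv ^^ Suc j) p = (pderiv ^^ j) (pderiv p)" for j
    by (simp only: funpow_Suc_right comp_def)
  then show ?case
    using IH root by (auto simp: less_Suc_eq_0_disj simp del: funpow.simps(2))
qed

lemma linear_power_dvd_if_pderivs_vanish:
  fixes p :: "'a :: field_char_0 poly"
  assumes "\<And>j. j < m \<Longrightarrow> poly ((pderiv ^^ j) p) a = 0"
  shows "[:- a, 1:] ^ m dvd p"
proof (cases "p = 0")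
  case False
  have "m \<le> Polynomial.order a p"
    using higher_pderiv_at_root[OF False refl, of a] assms not_le by blast
  then show ?thesis
    by (simp add: order_divides)
qed simp

subsection \<open>Families of polynomials depending on a real parameter\<close>

text \<open>\<open>P'\<close> is a single polynomial, the derivative at the one parameter
  \<open>s\<close>. The uniform degree bound turns evaluation into a sum of fixed length, so that
  coefficientwise limits pass to values.\<close>

definition has_coeff_derivative :: "(real \<Rightarrow> complex poly) \<Rightarrow> complex poly \<Rightarrow> real \<Rightarrow> bool" where
  "has_coeff_derivative P P' s \<longleftrightarrow>
     (\<forall>k. ((\<lambda>r. Polynomial.coeff (P r) k) has_vector_derivative Polynomial.coeff P' k) (at s))
     \<and> (\<exists>N. \<forall>r. Polynomial.degree (P r) \<le> N)"

lemma has_coeff_derivative_pderiv: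
  assumes "has_coeff_derivative P P' s"
  shows "has_coeff_derivative (\<lambda>r. pderiv (P r)) (pderiv P') s"
proof -
  obtain N where N: "\<And>r. Polynomial.degree (P r) \<le> N"
    using assms unfolding has_coeff_derivative_def by blast
  have "Polynomial.degree (pderiv (P r)) \<le> N" for r
    using N[of r] by (simp add: degree_pderiv)
  moreover have "((\<lambda>r. Polynomial.coeff (pderiv (P r)) k) has_vector_derivative
      Polynomial.coeff (pderiv P') k) (at s)" for k
    using assms unfolding has_coeff_derivative_def coeff_pderiv
    by (auto intro!: has_vector_derivative_mult_right)
  ultimately show ?thesis
    unfolding has_coeff_derivative_def by blast
qed

lemma has_coeff_derivative_higher_pderiv:
  "has_coeff_derivative P P' s \<Longrightarrow> has_coeff_derivative (\<lambda>r. (pderiv ^^ j) (P r)) ((pderiv ^^ j) P') s"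
  by (induction j) (auto dest: has_coeff_derivative_pderiv)

lemma vector_derivative_iff_quotient:
  fixes f :: "real \<Rightarrow> complex"
  shows "(f has_vector_derivative D) (at s) \<longleftrightarrow> (\<lambda>r. (f r - f s) / of_real (r - s)) \<midarrow>s\<rightarrow> D"
proof -
  have "(f has_vector_derivative D) (at s) \<longleftrightarrow>
      (\<lambda>r. norm (f r - f s - (r - s) *\<^sub>R D) / norm (r - s)) \<midarrow>s\<rightarrow> 0"
    unfolding has_vector_derivative_def has_derivative_iff_norm
    by (auto simp: bounded_linear_scaleR_left)
  also have "\<dots> \<longleftrightarrow> (\<lambda>r. norm ((f r - f s) / of_real (r - s) - D)) \<midarrow>s\<rightarrow> 0"
  proof (rule filterlim_cong[OF refl refl])
    show "\<forall>\<^sub>F r in at s. norm (f r - f s - (r - s) *\<^sub>R D) / norm (r - s)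
        = norm ((f r - f s) / of_real (r - s) - D)"
      unfolding eventually_at_filter
    proof (intro always_eventually allI impI)
      fix r assume "r \<noteq> s"
      then have "(f r - f s) / of_real (r - s) - D = (f r - f s - (r - s) *\<^sub>R D) / of_real (r - s)"
        by (simp add: field_simps scaleR_conv_of_real)
      then show "norm (f r - f s - (r - s) *\<^sub>R D) / norm (r - s)
        = norm ((f r - f s) / of_real (r - s) - D)"
        by (simp only: norm_divide norm_of_real real_norm_def)
    qed
  qed
  also have "\<dots> \<longleftrightarrow> (\<lambda>r. (f r - f s) / of_real (r - s)) \<midarrow>s\<rightarrow> D"
    by (metis (no_types) LIM_zero_iff tendsto_norm_zero_iff)
  finally show ?thesis .
qed

text \<open>Both polynomials in the numerator are evaluated at the same point
  \<open>\<xi> r\<close>, so continuity of \<open>\<xi>\<close> suffices. This allows roots to be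
  inserted before anything is known about their differentiability.\<close>

lemma poly_family_quotient_tendsto:
  assumes P: "has_coeff_derivative P P' s" and \<xi>: "isCont \<xi> s"
  shows "(\<lambda>r. (poly (P r) (\<xi> r) - poly (P s) (\<xi> r)) / of_real (r - s)) \<midarrow>s\<rightarrow> poly P' (\<xi> s)"
proof -
  obtain N where N: "\<And>r. Polynomial.degree (P r) \<le> N"
    using P unfolding has_coeff_derivative_def by blast
  have coeff: "(\<lambda>r. (Polynomial.coeff (P r) k - Polynomial.coeff (P s) k) / of_real (r - s))
      \<midarrow>s\<rightarrow> Polynomial.coeff P' k" for k
    using P unfolding has_coeff_derivative_def vector_derivative_iff_quotient by blast
  \<comment> \<open>Coefficients beyond \<open>N\<close> vanish for all \<open>r\<close>, hence so
    do their derivatives: \<open>N\<close> bounds the degree of \<open>P'\<close> as well.\<close>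
  have "Polynomial.coeff P' k = 0" if "k > N" for k
  proof -
    have "Polynomial.coeff (P r) k = 0" for r
      using N[of r] that by (intro coeff_eq_0) simp
    then show ?thesis
      using coeff[of k] by (simp add: LIM_const_eq[symmetric])
  qed
  then have N': "Polynomial.degree P' \<le> N"
    by (simp add: degree_le)
  have "(\<lambda>r. \<Sum>i\<le>N. (Polynomial.coeff (P r) i - Polynomial.coeff (P s) i) / of_real (r - s) * \<xi> r ^ i)
      \<midarrow>s\<rightarrow> (\<Sum>i\<le>N. Polynomial.coeff P' i * \<xi> s ^ i)"
    by (intro tendsto_sum tendsto_mult coeff tendsto_power) (use \<xi> in \<open>simp add: isCont_def\<close>)
  then show ?thesis
    using N N' by (simp add: poly_eq_sum_atMost[of _ N] sum_subtractf sum_divide_distrib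
        left_diff_distrib diff_divide_distrib)
qed

text \<open>
  If \<open>\<xi> s\<close> is a critical point of order \<open>m\<close> of \<open>P s\<close>, then \<open>P s - P s (\<xi> s)\<close> equals, near \<open>\<xi> s\<close>
  and up to a bounded factor, \<open>(p - \<xi> s) * pderiv (P s)\<close>. At \<open>p = \<xi> r\<close> the factor
  \<open>pderiv (P s)\<close> is \<open>O (r - s)\<close>, so the motion of \<open>\<xi>\<close> contributes \<open>o (r - s)\<close> only, although
  \<open>\<xi>\<close> itself need not be differentiable.
\<close>

lemma critical_value_has_vector_derivative:
  assumes P: "has_coeff_derivative P P' s" and \<xi>: "isCont \<xi> s"
    and crit: "\<And>r. poly (pderiv (P r)) (\<xi> r) = 0" and nz: "pderiv (P s) \<noteq> 0"
  shows "((\<lambda>r. poly (P r) (\<xi> r)) has_vector_derivative poly P' (\<xi> s)) (at s)"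
proof -
  \<comment> \<open>Subtracting the critical value makes \<open>\<xi> s\<close> a root of
    \<open>q\<close>, of order one more than its order in \<open>pderiv q\<close>.\<close>
  define q where "q = P s - [:poly (P s) (\<xi> s):]"
  have pq: "pderiv q = pderiv (P s)"
    by (simp add: q_def pderiv_diff pderiv_pCons)
  have q0: "poly q (\<xi> s) = 0" and qnz: "q \<noteq> 0"
    using nz pq by (auto simp: q_def)
  define m where "m = Polynomial.order (\<xi> s) (pderiv q)"
  have "Polynomial.order (\<xi> s) q = Suc m"
    unfolding m_def using nz pq q0 qnz by (intro order_pderiv) (auto simp: order_root)
  then obtain G where G: "q = [:- \<xi> s, 1:] ^ Suc m * G"
    using order_decomp[OF qnz, of "\<xi> s"] by auto
  obtain H where H: "pderiv q = [:- \<xi> s, 1:] ^ m * H" "\<not> [:- \<xi> s, 1:] dvd H"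
    using order_decomp[of "pderiv q" "\<xi> s"] nz pq unfolding m_def by auto
  have H0: "poly H (\<xi> s) \<noteq> 0"
    using H(2) by (simp add: poly_eq_0_iff_dvd)
  have \<xi>': "\<xi> \<midarrow>s\<rightarrow> \<xi> s"
    using \<xi> by (simp add: isCont_def)
  have lim: "(\<lambda>r. poly p (\<xi> r)) \<midarrow>s\<rightarrow> poly p (\<xi> s)" for p
    using \<xi>' by (intro tendsto_intros) auto
  \<comment> \<open>Since \<open>pderiv (P r)\<close> vanishes at \<open>\<xi> r\<close>, the
    negated quotient is \<open>pderiv (P s)\<close> at \<open>\<xi> r\<close> divided by
    \<open>r - s\<close>. Multiplying it by \<open>(\<xi> r - \<xi> s) * G / H\<close> turns it into
    \<open>q\<close> at \<open>\<xi> r\<close> divided by \<open>r - s\<close>; the factor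
    \<open>\<xi> r - \<xi> s\<close> sends the limit to 0.\<close>
  have "(\<lambda>r. (\<xi> r - \<xi> s) * poly G (\<xi> r) / poly H (\<xi> r)
        * - ((poly (pderiv (P r)) (\<xi> r) - poly (pderiv (P s)) (\<xi> r)) / of_real (r - s)))
      \<midarrow>s\<rightarrow> (\<xi> s - \<xi> s) * poly G (\<xi> s) / poly H (\<xi> s) * - poly (pderiv P') (\<xi> s)"
    by (intro tendsto_intros \<xi>' lim H0
        poly_family_quotient_tendsto[OF has_coeff_derivative_pderiv[OF P] \<xi>])
  moreover have "\<forall>\<^sub>F r in at s. (\<xi> r - \<xi> s) * poly G (\<xi> r) / poly H (\<xi> r)
        * - ((poly (pderiv (P r)) (\<xi> r) - poly (pderiv (P s)) (\<xi> r)) / of_real (r - s))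
      = poly q (\<xi> r) / of_real (r - s)"
    using tendsto_imp_eventually_ne[OF lim H0]
  proof eventually_elim
    case (elim r)
    define d where "d = \<xi> r - \<xi> s"
    have lin: "poly [:- \<xi> s, 1:] (\<xi> r) = d"
      by (simp add: d_def)
    have "poly (pderiv (P s)) (\<xi> r) = d ^ m * poly H (\<xi> r)"
      using arg_cong[OF H(1), of "\<lambda>p. poly p (\<xi> r)"] pq by (simp only: poly_mult poly_power lin)
    moreover have "poly q (\<xi> r) = d ^ Suc m * poly G (\<xi> r)"
      using arg_cong[OF G, of "\<lambda>p. poly p (\<xi> r)"] by (simp only: poly_mult poly_power lin)
    ultimately show ?case
      using elim unfolding d_def[symmetric] crit[of r] by simp
  qed
  ultimately have "(\<lambda>r. poly q (\<xi> r) / of_real (r - s)) \<midarrow>s\<rightarrow> 0"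
    by (simp add: tendsto_cong)
  from tendsto_add[OF poly_family_quotient_tendsto[OF P \<xi>] this]
  show ?thesis
    unfolding vector_derivative_iff_quotient by (simp add: q_def add_divide_distrib[symmetric])
qed

text \<open>Implicit differentiation for a root known only to be continuous. With
  \<open>R s = [:- \<xi> s, 1:] * S\<close>, the increment \<open>\<xi> r - \<xi> s\<close> times
  \<open>poly S (\<xi> r)\<close> is minus the change of the polynomial at \<open>\<xi> r\<close>,
  and \<open>poly S (\<xi> s)\<close> is the nonzero value of \<open>pderiv (R s)\<close> at
  \<open>\<xi> s\<close>.\<close>

lemma simple_root_has_vector_derivative:
  assumes R: "has_coeff_derivative R R' s" and \<xi>: "isCont \<xi> s"
    and root: "\<forall>\<^sub>F r in nhds s. poly (R r) (\<xi> r) = 0"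
    and simple: "poly (pderiv (R s)) (\<xi> s) \<noteq> 0"
  shows "(\<xi> has_vector_derivative (- poly R' (\<xi> s) / poly (pderiv (R s)) (\<xi> s))) (at s)"
proof -
  have "poly (R s) (\<xi> s) = 0"
    using root by (rule eventually_nhds_x_imp_x)
  then obtain S where S: "R s = [:- \<xi> s, 1:] * S"
    by (auto simp: poly_eq_0_iff_dvd)
  have S0: "poly S (\<xi> s) = poly (pderiv (R s)) (\<xi> s)"
    unfolding S by (subst pderiv_mult) (simp add: pderiv_pCons)
  have lim: "(\<lambda>r. poly S (\<xi> r)) \<midarrow>s\<rightarrow> poly S (\<xi> s)"
    using \<xi> by (intro tendsto_intros) (simp add: isCont_def)
  have Snz: "poly S (\<xi> s) \<noteq> 0"
    using simple S0 by simp
  have "(\<lambda>r. - ((poly (R r) (\<xi> r) - poly (R s) (\<xi> r)) / of_real (r - s)) / poly S (\<xi> r))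
      \<midarrow>s\<rightarrow> - poly R' (\<xi> s) / poly S (\<xi> s)"
    by (intro tendsto_intros lim Snz poly_family_quotient_tendsto[OF R \<xi>])
  moreover have "\<forall>\<^sub>F r in at s.
      - ((poly (R r) (\<xi> r) - poly (R s) (\<xi> r)) / of_real (r - s)) / poly S (\<xi> r)
      = (\<xi> r - \<xi> s) / of_real (r - s)"
    using tendsto_imp_eventually_ne[OF lim Snz] conjunct1[OF iffD1[OF eventually_nhds_conv_at root]]
  proof eventually_elim
    case (elim r)
    define d where "d = \<xi> r - \<xi> s"
    have lin: "poly [:- \<xi> s, 1:] (\<xi> r) = d"
      by (simp add: d_def)
    have "poly (R s) (\<xi> r) = d * poly S (\<xi> r)"
      using arg_cong[OF S, of "\<lambda>p. poly p (\<xi> r)"] by (simp only: poly_mult lin)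
    then show ?case
      using elim unfolding d_def[symmetric] by simp
  qed
  ultimately show ?thesis
    unfolding vector_derivative_iff_quotient S0 by (simp add: tendsto_cong)
qed

text \<open>This differentiates \<open>poly (R r) (\<xi> r) = 0\<close> in \<open>r\<close>. The
  root may be multiple here, but its derivative \<open>d\<close> is given.\<close>

lemma poly_family_derivative_along_root:
  assumes R: "has_coeff_derivative R R' s" and \<xi>: "(\<xi> has_vector_derivative d) (at s)"
    and root: "\<forall>\<^sub>F r in nhds s. poly (R r) (\<xi> r) = 0"
  shows "poly R' (\<xi> s) = - d * poly (pderiv (R s)) (\<xi> s)"
proof -
  have cont: "isCont \<xi> s"
    using \<xi> has_vector_derivative_continuous by blast
  have r0: "poly (R s) (\<xi> s) = 0"
    using root by (rule eventually_nhds_x_imp_x)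
  have "((poly (R s) \<circ> \<xi>) has_vector_derivative d * poly (pderiv (R s)) (\<xi> s)) (at s)"
    by (intro field_vector_diff_chain_at \<xi> poly_DERIV)
  then have "(\<lambda>r. - ((poly (R s) (\<xi> r) - poly (R s) (\<xi> s)) / of_real (r - s)))
      \<midarrow>s\<rightarrow> - (d * poly (pderiv (R s)) (\<xi> s))"
    unfolding vector_derivative_iff_quotient by (intro tendsto_minus) (simp add: o_def)
  moreover have "\<forall>\<^sub>F r in at s. (poly (R r) (\<xi> r) - poly (R s) (\<xi> r)) / of_real (r - s)
      = - ((poly (R s) (\<xi> r) - poly (R s) (\<xi> s)) / of_real (r - s))"
    using conjunct1[OF iffD1[OF eventually_nhds_conv_at root]]
    by eventually_elim (simp add: r0 field_simps)
  ultimately have "(\<lambda>r. (poly (R r) (\<xi> r) - poly (R s) (\<xi> r)) / of_real (r - s))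
      \<midarrow>s\<rightarrow> - (d * poly (pderiv (R s)) (\<xi> s))"
    by (simp add: tendsto_cong)
  with poly_family_quotient_tendsto[OF R cont] show ?thesis
    by (simp add: LIM_unique)
qed

text \<open>If the multiplicity stays \<open>m\<close>, then \<open>\<xi>\<close> is a simple root
  of the \<open>m\<close>-th derivative of \<open>P\<close> and hence differentiable.
  Differentiating the vanishing of the derivatives of order 1 to \<open>m - 1\<close> along
  \<open>\<xi>\<close> shows that the same derivatives of \<open>P'\<close> vanish, because those of
  \<open>P\<close> one order higher do too; order 0 is the hypothesis \<open>root\<close>.\<close>

lemma constant_order_root_dvd:
  assumes P: "has_coeff_derivative P P' s" and \<xi>: "isCont \<xi> s"
    and ord: "\<forall>\<^sub>F r in nhds s. pderiv (P r) \<noteq> 0 \<and> Polynomial.order (\<xi> r) (pderiv (P r)) = m"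
    and m: "m > 0" and root: "poly P' (\<xi> s) = 0"
  shows "[:- \<xi> s, 1:] ^ m dvd P'"
proof (rule linear_power_dvd_if_pderivs_vanish)
  fix j assume j: "j < m"
  have shift: "(pderiv ^^ Suc i) p = (pderiv ^^ i) (pderiv p)" for i and p :: "complex poly"
    by (simp only: funpow_Suc_right comp_def)
  have van: "\<forall>\<^sub>F r in nhds s. poly ((pderiv ^^ Suc i) (P r)) (\<xi> r) = 0" if "i < m" for i
    using ord
  proof eventually_elim
    case (elim r)
    then show ?case
      unfolding shift using higher_pderiv_at_root that by blast
  qed
  have nv: "poly ((pderiv ^^ Suc m) (P s)) (\<xi> s) \<noteq> 0"
    unfolding shift using higher_pderiv_at_root eventually_nhds_x_imp_x[OF ord] by blast
  obtain k where k: "m = Suc k"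
    using m by (cases m) auto
  obtain d where d: "(\<xi> has_vector_derivative d) (at s)"
    using simple_root_has_vector_derivative[OF has_coeff_derivative_higher_pderiv[OF P] \<xi> van[of k]]
      nv k by auto
  show "poly ((pderiv ^^ j) P') (\<xi> s) = 0"
  proof (cases j)
    case (Suc i)
    have "i < m"
      using j Suc by simp
    have "poly ((pderiv ^^ Suc i) P') (\<xi> s) = - d * poly (pderiv ((pderiv ^^ Suc i) (P s))) (\<xi> s)"
      by (rule poly_family_derivative_along_root[OF has_coeff_derivative_higher_pderiv[OF P] d van[OF \<open>i < m\<close>]])
    moreover have "poly ((pderiv ^^ Suc (Suc i)) (P s)) (\<xi> s) = 0"
      using eventually_nhds_x_imp_x[OF van] j Suc by blast
    ultimately show ?thesis
      using Suc by simp
  qed (use root in simp)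
qed

lemma eq_if_dense_eq:
  fixes f g :: "real \<Rightarrow> 'a :: t2_space"
  assumes f: "continuous_on UNIV f" and g: "continuous_on UNIV g"
    and dense: "\<And>a b. a < b \<Longrightarrow> \<exists>s\<in>{a<..<b}. f s = g s"
  shows "f = g"
proof (rule ccontr)
  assume "f \<noteq> g"
  then obtain s where "s \<in> {r. f r \<noteq> g r}"
    by blast
  moreover have "open {r. f r \<noteq> g r}"
    using f g by (rule open_Collect_neq)
  ultimately obtain e where "e > 0" "ball s e \<subseteq> {r. f r \<noteq> g r}"
    by (meson openE)
  moreover obtain r where "r \<in> {s - e<..<s + e}" "f r = g r"
    using dense[of "s - e" "s + e"] \<open>e > 0\<close> by auto
  ultimately show False
    by (auto simp: ball_eq_greaterThanLessThan)
qed

text \<open>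
  On a dense set of parameters the coincidence pattern of the roots is locally constant, and
  \<open>constant_order_root_dvd\<close> applies; the resulting identity is closed in \<open>s\<close>.
\<close>

lemma eq_smult_prod_critical_points:
  fixes \<rho> :: "'k \<Rightarrow> real \<Rightarrow> complex"
  assumes K: "finite K" and P: "\<And>s. has_coeff_derivative P (P' s) s"
    and \<rho>: "\<And>k. k \<in> K \<Longrightarrow> continuous_on UNIV (\<rho> k)"
    and fact: "\<And>s. pderiv (P s) = [:- \<nu> s, 1:] * (\<Prod>k\<in>K. [:- \<rho> k s, 1:])"
    and \<nu>: "\<And>k s. k \<in> K \<Longrightarrow> \<rho> k s \<noteq> \<nu> s"
    and root: "\<And>k s. k \<in> K \<Longrightarrow> poly (P' s) (\<rho> k s) = 0"
    and deg: "\<And>s. Polynomial.degree (P' s) \<le> card K"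
    and cont: "\<And>j. continuous_on UNIV (\<lambda>s. Polynomial.coeff (P' s) j)"
  shows "P' s = Polynomial.smult (Polynomial.coeff (P' s) (card K)) (\<Prod>k\<in>K. [:- \<rho> k s, 1:])"
proof -
  define Q where "Q s = (\<Prod>k\<in>K. [:- \<rho> k s, 1:])" for s
  have Q_nz: "Q s \<noteq> 0" for s
    unfolding Q_def using K by (subst prod_zero_iff) auto
  have Q_deg: "Polynomial.degree (Q s) = card K" for s
    unfolding Q_def by (subst degree_prod_eq_sum_degree) auto
  have Q_lead: "Polynomial.coeff (Q s) (card K) = 1" for s
  proof -
    have "Polynomial.coeff (Q s) (Polynomial.degree (Q s)) = 1"
      unfolding Q_def lead_coeff_prod by simp
    then show ?thesis
      unfolding Q_deg .
  qed
  have pderiv_nz: "pderiv (P s) \<noteq> 0" for s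
    using Q_nz[of s] unfolding fact Q_def[symmetric] by (simp del: mult_pCons_left)
  \<comment> \<open>\<open>E s\<close> is the coincidence relation of the roots on their indices;
    the order of a root is the size of its class.\<close>
  define E where "E s = {(j, k) \<in> K \<times> K. \<rho> j s = \<rho> k s}" for s
  have E_fin: "finite (E s)" for s
    by (rule finite_subset[of _ "K \<times> K"]) (use K in \<open>auto simp: E_def\<close>)
  have ord: "Polynomial.order (\<rho> j s) (pderiv (P s)) = card {k. (k, j) \<in> E s}" if "j \<in> K" for j s
  proof -
    have "Polynomial.order (\<rho> j s) [:- \<nu> s, 1:] = 0"
      using \<nu>[OF that] by (intro order_0I) simp
    moreover have "Polynomial.order (\<rho> j s) (pderiv (P s))
        = Polynomial.order (\<rho> j s) [:- \<nu> s, 1:] + Polynomial.order (\<rho> j s) (Q s)"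
      using pderiv_nz[of s] unfolding fact Q_def[symmetric] by (rule order_mult)
    moreover have "{k \<in> K. \<rho> k s = \<rho> j s} = {k. (k, j) \<in> E s}"
      using that by (auto simp: E_def)
    ultimately show ?thesis
      using order_prod_linear_factors[OF K, of "\<rho> j s" "\<lambda>k. \<rho> k s"] by (simp add: Q_def)
  qed
  have dense: "\<exists>s\<in>{a<..<b}. P' s = Polynomial.smult (Polynomial.coeff (P' s) (card K)) (Q s)"
    if ab: "a < b" for a b
  proof -
    \<comment> \<open>Inside this proof \<open>dense\<close> is still the order density of the
      reals. At a parameter with the fewest coincidences the pattern is locally constant: distinct
      roots stay distinct nearby, so \<open>E\<close> can only shrink, and minimality forbids
      that.\<close>
    obtain s where s: "s \<in> {a<..<b}" and min: "\<And>r. r \<in> {a<..<b} \<Longrightarrow> card (E s) \<le> card (E r)"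
      using ex_has_least_nat[of "\<lambda>s. s \<in> {a<..<b}" _ "\<lambda>s. card (E s)"] dense[OF ab]
      by (metis greaterThanLessThan_iff)
    have "\<forall>\<^sub>F r in nhds s. \<forall>(j, k) \<in> K \<times> K - E s. \<rho> j r \<noteq> \<rho> k r"
    proof (rule eventually_ball_finite)
      show "\<forall>x\<in>K \<times> K - E s. \<forall>\<^sub>F r in nhds s. case x of (j, k) \<Rightarrow> \<rho> j r \<noteq> \<rho> k r"
      proof safe
        fix j k assume jk: "j \<in> K" "k \<in> K" "(j, k) \<notin> E s"
        have "open {r. \<rho> j r \<noteq> \<rho> k r}"
          using \<rho> jk by (intro open_Collect_neq) auto
        then show "\<forall>\<^sub>F r in nhds s. \<rho> j r \<noteq> \<rho> k r"
          using jk by (auto simp: eventually_nhds E_def)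
      qed
    qed (use K in simp)
    moreover have "\<forall>\<^sub>F r in nhds s. r \<in> {a<..<b}"
      using s by (intro eventually_nhds_in_open) auto
    ultimately have E_const: "\<forall>\<^sub>F r in nhds s. E r = E s"
    proof eventually_elim
      case (elim r)
      then have "E r \<subseteq> E s"
        by (auto simp: E_def)
      then show ?case
        using min[of r] elim E_fin[of s] by (intro card_seteq) auto
    qed
    have pow: "[:- \<rho> j s, 1:] ^ card {k. (k, j) \<in> E s} dvd P' s" if j: "j \<in> K" for j
    proof (rule constant_order_root_dvd[OF P])
      show "isCont (\<rho> j) s"
        using \<rho>[OF j] by (simp add: continuous_on_eq_continuous_at)
      show "\<forall>\<^sub>F r in nhds s. pderiv (P r) \<noteq> 0
          \<and> Polynomial.order (\<rho> j r) (pderiv (P r)) = card {k. (k, j) \<in> E s}"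
        using E_const by eventually_elim (simp add: pderiv_nz ord j)
      show "0 < card {k. (k, j) \<in> E s}"
        using j K by (auto simp: card_gt_0_iff E_def intro: finite_subset[of _ K])
      show "poly (P' s) (\<rho> j s) = 0"
        by (rule root[OF j])
    qed
    have "Q s dvd P' s"
    proof (cases "P' s = 0")
      case False
      show ?thesis
        unfolding Q_def
      proof (rule prod_linear_factors_dvd[OF K False])
        fix a
        show "card {k \<in> K. \<rho> k s = a} \<le> Polynomial.order a (P' s)"
        proof (cases "\<exists>j\<in>K. \<rho> j s = a")
          case True
          then obtain j where j: "j \<in> K" "a = \<rho> j s"
            by blast
          have "{k \<in> K. \<rho> k s = a} = {k. (k, j) \<in> E s}"
            using j by (auto simp: E_def)
          then show ?thesis
            using pow[OF j(1)] False j(2) by (simp add: order_divides)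
        next
          case False
          then have "{k \<in> K. \<rho> k s = a} = {}"
            by blast
          then show ?thesis
            by (simp only: card.empty le0)
        qed
      qed
    qed simp
    then obtain R where R: "P' s = Q s * R"
      by blast
    \<comment> \<open>The degree bound \<open>card K\<close> leaves only a constant cofactor; it is
      the top coefficient because \<open>Q s\<close> is monic.\<close>
    have "Polynomial.degree R = 0"
    proof (cases "R = 0")
      case False
      then have "Polynomial.degree (P' s) = card K + Polynomial.degree R"
        unfolding R using Q_nz[of s] by (simp add: degree_mult_eq Q_deg)
      then show ?thesis
        using deg[of s] by simp
    qed simp
    then obtain c where "R = [:c:]"
      by (rule degree_eq_zeroE)
    then have "P' s = Polynomial.smult c (Q s)"
      unfolding R by simp
    then have "P' s = Polynomial.smult (Polynomial.coeff (P' s) (card K)) (Q s)"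
      using Q_lead[of s] by simp
    then show ?thesis
      using s by blast
  qed
  \<comment> \<open>Evaluating at a fixed \<open>w\<close> gives continuous scalar functions of
    \<open>s\<close>, to which density applies.\<close>
  have "(\<lambda>s. poly (P' s) w) = (\<lambda>s. Polynomial.coeff (P' s) (card K) * (\<Prod>k\<in>K. w - \<rho> k s))" for w
  proof (rule eq_if_dense_eq)
    show "continuous_on UNIV (\<lambda>s. poly (P' s) w)"
      unfolding poly_eq_sum_atMost[OF deg] by (intro continuous_intros cont)
    show "continuous_on UNIV (\<lambda>s. Polynomial.coeff (P' s) (card K) * (\<Prod>k\<in>K. w - \<rho> k s))"
      by (intro continuous_intros cont \<rho>)
    fix a b :: real assume "a < b"
    then obtain s where s: "s \<in> {a<..<b}"
      and eq: "P' s = Polynomial.smult (Polynomial.coeff (P' s) (card K)) (Q s)"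
      using dense by blast
    have "poly (P' s) w = Polynomial.coeff (P' s) (card K) * (\<Prod>k\<in>K. w - \<rho> k s)"
      using arg_cong[OF eq, of "\<lambda>p. poly p w"] by (simp add: Q_def poly_prod)
    then show "\<exists>s\<in>{a<..<b}. poly (P' s) w = Polynomial.coeff (P' s) (card K) * (\<Prod>k\<in>K. w - \<rho> k s)"
      using s by blast
  qed
  then have "poly (P' s) w = poly (Polynomial.smult (Polynomial.coeff (P' s) (card K)) (Q s)) w" for w
    by (auto simp: Q_def poly_prod dest: fun_cong)
  then show ?thesis
    unfolding Q_def by (intro poly_eqI_degree[of UNIV] poly_eq_poly_eq_iff[THEN iffD1] ext)
qed

subsection \<open>Calculus\<close>

text \<open>
  No second derivative of \<open>g\<close> is needed: with \<open>B (t, \<tau>) = \<integral> f (t, x) * g\<^sub>x (\<tau>, x) dx\<close>,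
  the derivative in \<open>\<tau>\<close> is taken after an integration by parts in \<open>x\<close>.
\<close>

lemma DERIV_integral_mult_partial:
  fixes f g ft fx gt gx :: "real \<times> real \<Rightarrow> real"
  assumes ft: "\<And>t x. ((\<lambda>s. f (s, x)) has_real_derivative ft (t, x)) (at t)"
    and fx: "\<And>t x. ((\<lambda>y. f (t, y)) has_real_derivative fx (t, x)) (at x)"
    and gt: "\<And>t x. ((\<lambda>s. g (s, x)) has_real_derivative gt (t, x)) (at t)"
    and gx: "\<And>t x. ((\<lambda>y. g (t, y)) has_real_derivative gx (t, x)) (at x)"
    and cont: "continuous_on UNIV f" "continuous_on UNIV g" "continuous_on UNIV ft"
      "continuous_on UNIV fx" "continuous_on UNIV gt" "continuous_on UNIV gx"
    and ab: "a \<le> b"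
  shows "((\<lambda>t. integral {a..b} (\<lambda>x. f (t, x) * gx (t, x))) has_real_derivative
      integral {a..b} (\<lambda>x. ft (t, x) * gx (t, x) - fx (t, x) * gt (t, x))
      + (f (t, b) * gt (t, b) - f (t, a) * gt (t, a))) (at t)"
proof -
  have c: "continuous_on A (\<lambda>z. h (p z, q z))"
    if "continuous_on UNIV h" "continuous_on A p" "continuous_on A q"
    for h :: "real \<times> real \<Rightarrow> real" and p q and A :: "'b :: topological_space set"
    by (rule continuous_on_compose2[OF that(1) continuous_on_Pair[OF that(2,3)]]) simp
  note c = c[OF cont(1)] c[OF cont(2)] c[OF cont(3)] c[OF cont(4)] c[OF cont(5)] c[OF cont(6)]
  define B where "B t \<tau> = integral {a..b} (\<lambda>x. f (t, x) * gx (\<tau>, x))" for t \<tau>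
  define Bt where "Bt t \<tau> = integral {a..b} (\<lambda>x. ft (t, x) * gx (\<tau>, x))" for t \<tau>
  define B\<tau> where "B\<tau> t \<tau> = f (t, b) * gt (\<tau>, b) - f (t, a) * gt (\<tau>, a)
    - integral {a..b} (\<lambda>x. fx (t, x) * gt (\<tau>, x))" for t \<tau>
  have Bt: "((\<lambda>t. B t \<tau>) has_real_derivative Bt t \<tau>) (at t)" for t \<tau>
    unfolding B_def Bt_def cbox_interval[symmetric]
  proof (rule leibniz_rule_field_derivative)
    show "continuous_on (UNIV \<times> cbox a b) (\<lambda>(t, x). ft (t, x) * gx (\<tau>, x))"
      unfolding case_prod_unfold by (intro continuous_intros c)
  qed (auto intro!: derivative_eq_intros ft integrable_continuous_interval continuous_intros c)
  \<comment> \<open>After integration by parts \<open>\<tau>\<close> enters through \<open>g\<close>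
    instead of \<open>gx\<close>, so the integral can be differentiated in \<open>\<tau>\<close>
    using \<open>gt\<close> alone.\<close>
  have parts: "B t \<tau> = f (t, b) * g (\<tau>, b) - f (t, a) * g (\<tau>, a)
      - integral {a..b} (\<lambda>x. fx (t, x) * g (\<tau>, x))" for t \<tau>
  proof -
    have "((\<lambda>x. f (t, x) * gx (\<tau>, x) + fx (t, x) * g (\<tau>, x)) has_integral
        f (t, b) * g (\<tau>, b) - f (t, a) * g (\<tau>, a)) {a..b}"
    proof (rule fundamental_theorem_of_calculus[OF ab])
      show "((\<lambda>x. f (t, x) * g (\<tau>, x)) has_vector_derivative
          f (t, x) * gx (\<tau>, x) + fx (t, x) * g (\<tau>, x)) (at x within {a..b})" for x
        using DERIV_mult'[OF fx gx]
        by (simp add: has_real_derivative_iff_has_vector_derivative has_vector_derivative_at_within)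
    qed
    then have "integral {a..b} (\<lambda>x. f (t, x) * gx (\<tau>, x) + fx (t, x) * g (\<tau>, x))
        = f (t, b) * g (\<tau>, b) - f (t, a) * g (\<tau>, a)"
      by (rule integral_unique)
    moreover have "integral {a..b} (\<lambda>x. f (t, x) * gx (\<tau>, x) + fx (t, x) * g (\<tau>, x))
        = integral {a..b} (\<lambda>x. f (t, x) * gx (\<tau>, x)) + integral {a..b} (\<lambda>x. fx (t, x) * g (\<tau>, x))"
      by (intro integral_add integrable_continuous_interval continuous_intros c)
    ultimately show ?thesis
      unfolding B_def by linarith
  qed
  have B\<tau>: "((\<lambda>\<tau>. B t \<tau>) has_real_derivative B\<tau> t \<tau>) (at \<tau>)" for t \<tau>
  proof -
    have "((\<lambda>\<tau>. integral {a..b} (\<lambda>x. fx (t, x) * g (\<tau>, x))) has_real_derivative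
        integral {a..b} (\<lambda>x. fx (t, x) * gt (\<tau>, x))) (at \<tau>)"
      unfolding cbox_interval[symmetric]
    proof (rule leibniz_rule_field_derivative)
      show "continuous_on (UNIV \<times> cbox a b) (\<lambda>(\<tau>, x). fx (t, x) * gt (\<tau>, x))"
        unfolding case_prod_unfold by (intro continuous_intros c)
    qed (auto intro!: derivative_eq_intros gt integrable_continuous_interval continuous_intros c)
    then show ?thesis
      unfolding parts B\<tau>_def by (auto intro!: derivative_eq_intros gt)
  qed
  have B\<tau>_cont: "continuous_on UNIV (\<lambda>z. B\<tau> (fst z) (snd z))"
  proof -
    have "continuous_on UNIV (\<lambda>z :: real \<times> real. integral (cbox a b) (\<lambda>x. fx (fst z, x) * gt (snd z, x)))"
      by (rule integral_continuous_on_param)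
        (auto intro!: continuous_intros c simp: case_prod_unfold)
    then show ?thesis
      unfolding B\<tau>_def by (intro continuous_intros c) simp
  qed
  \<comment> \<open>Joint differentiability follows from the derivative in \<open>t\<close> and the
    continuous partial derivative in \<open>\<tau>\<close>; the diagonal is inserted afterwards by
    the chain rule.\<close>
  have "((\<lambda>(t, \<tau>). B t \<tau>) has_derivative (\<lambda>(dt, d\<tau>). Bt t t * dt + blinfun_mult_right (B\<tau> t t) d\<tau>))
      (at (t, t) within UNIV \<times> UNIV)"
  proof (rule has_derivative_partialsI[where fx = "(*) (Bt t t)" and fy = "\<lambda>t \<tau>. blinfun_mult_right (B\<tau> t \<tau>)"])
    show "((\<lambda>t'. B t' t) has_derivative (*) (Bt t t)) (at t within UNIV)"
      using Bt by (simp add: has_field_derivative_def)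
    show "((\<lambda>\<tau>. B t' \<tau>) has_derivative blinfun_apply (blinfun_mult_right (B\<tau> t' \<tau>))) (at \<tau> within UNIV)" for t' \<tau>
      using B\<tau>[of t' \<tau>] by (simp add: has_field_derivative_def)
    have "continuous_on UNIV (\<lambda>z. blinfun_mult_right (B\<tau> (fst z) (snd z)))"
      by (rule bounded_linear.continuous_on[OF bounded_linear_blinfun_mult_right B\<tau>_cont])
    then show "continuous (at (t, t) within UNIV \<times> UNIV) (\<lambda>(x, y). blinfun_mult_right (B\<tau> x y))"
      by (simp add: continuous_on_eq_continuous_at case_prod_unfold)
  qed auto
  moreover have "((\<lambda>s. (s, s)) has_derivative (\<lambda>d. (d, d))) (at t)"
    by (intro has_derivative_Pair has_derivative_ident)
  ultimately have "((\<lambda>s. B s s) has_derivative (\<lambda>d. Bt t t * d + B\<tau> t t * d)) (at t)"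
    using has_derivative_compose[of "\<lambda>s. (s, s)" "\<lambda>d. (d, d)" t UNIV "\<lambda>(t, \<tau>). B t \<tau>"] by fastforce
  moreover have "(\<lambda>d. Bt t t * d + B\<tau> t t * d) = (*) (Bt t t + B\<tau> t t)"
    by (simp add: fun_eq_iff distrib_right)
  ultimately have "((\<lambda>s. B s s) has_real_derivative Bt t t + B\<tau> t t) (at t)"
    unfolding has_field_derivative_def by simp
  moreover have "integral {a..b} (\<lambda>x. ft (t, x) * gx (t, x) - fx (t, x) * gt (t, x))
      = Bt t t - integral {a..b} (\<lambda>x. fx (t, x) * gt (t, x))"
    unfolding Bt_def
    by (intro integral_diff integrable_continuous_interval continuous_intros c)
  then have "Bt t t + B\<tau> t t = integral {a..b} (\<lambda>x. ft (t, x) * gx (t, x) - fx (t, x) * gt (t, x))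
      + (f (t, b) * gt (t, b) - f (t, a) * gt (t, a))"
    by (simp add: B\<tau>_def)
  ultimately show ?thesis
    by (simp only: B_def)
qed

text \<open>Integrating factor: \<open>e x * exp (- W x)\<close> is constant for an antiderivative
  \<open>W\<close> of \<open>w\<close> on a compact interval containing \<open>a\<close> and
  \<open>s\<close>.\<close>

lemma linear_ode_zero:
  fixes e :: "real \<Rightarrow> real"
  assumes e: "\<And>s. (e has_real_derivative w s * e s) (at s)" and w: "continuous_on UNIV w"
    and zero: "e a = 0"
  shows "e s = 0"
proof -
  obtain W where W: "\<And>x. x \<in> {min a s - 1..max a s + 1} \<Longrightarrow>
      (W has_real_derivative w x) (at x within {min a s - 1..max a s + 1})"
    using antiderivative_continuous[of "min a s - 1" "max a s + 1" w] w
    by (metis (no_types) continuous_on_subset has_real_derivative_iff_has_vector_derivative subset_UNIV)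
  have "((\<lambda>x. e x * exp (- W x)) has_real_derivative 0) (at x within {min a s - 1..max a s + 1})"
    if "x \<in> {min a s - 1..max a s + 1}" for x
    using that
    by (auto intro!: derivative_eq_intros W has_field_derivative_at_within[OF e])
  then obtain c where "\<And>x. x \<in> {min a s - 1..max a s + 1} \<Longrightarrow> e x * exp (- W x) = c"
    using has_field_derivative_zero_constant[of "{min a s - 1..max a s + 1}" "\<lambda>x. e x * exp (- W x)"]
    by (metis (no_types, lifting) convex_real_interval(5))
  moreover have "a \<in> {min a s - 1..max a s + 1}" "s \<in> {min a s - 1..max a s + 1}"
    unfolding atLeastAtMost_iff by linarith+
  ultimately have "e a * exp (- W a) = c" "e s * exp (- W s) = c"
    by blast+
  then show ?thesis
    using zero by auto
qed

section \<open>Continuously differentiable functions on the plane\<close>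

lemma C_1_has_derivative:
  assumes "C_k 1 f"
  shows "(f has_derivative (\<lambda>(a, b). a * partial_t f z + b * partial_x f z)) (at z)"
proof -
  have "f differentiable (at z)"
    using assms by (cases z) (simp add: differentiable_on_def)
  then obtain f' where f': "(f has_derivative f') (at z)"
    by (auto simp: differentiable_def)
  then interpret f': bounded_linear f'
    by (rule has_derivative_bounded_linear)
  have dt: "((\<lambda>s. f (s, snd z)) has_derivative (\<lambda>h. f' (h, 0))) (at (fst z))"
    by (rule has_derivative_compose[of "\<lambda>s. (s, snd z)", simplified]) (auto intro!: derivative_eq_intros f')
  have lt: "(\<lambda>h. f' (h, 0)) = (*) (f' (1, 0))"
  proof
    fix h show "f' (h, 0) = f' (1, 0) * h"
      using f'.scaleR[of h "(1, 0)"] by simp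
  qed
  have t: "partial_t f z = f' (1, 0)"
    unfolding partial_t_def
    by (rule DERIV_imp_deriv) (unfold has_field_derivative_def, rule has_derivative_eq_rhs[OF dt lt])
  have dx: "((\<lambda>y. f (fst z, y)) has_derivative (\<lambda>h. f' (0, h))) (at (snd z))"
    by (rule has_derivative_compose[of "\<lambda>y. (fst z, y)", simplified]) (auto intro!: derivative_eq_intros f')
  have lx: "(\<lambda>h. f' (0, h)) = (*) (f' (0, 1))"
  proof
    fix h show "f' (0, h) = f' (0, 1) * h"
      using f'.scaleR[of h "(0, 1)"] by simp
  qed
  have x: "partial_x f z = f' (0, 1)"
    unfolding partial_x_def
    by (rule DERIV_imp_deriv) (unfold has_field_derivative_def, rule has_derivative_eq_rhs[OF dx lx])
  have ab: "f' (a, b) = a * f' (1, 0) + b * f' (0, 1)" for a b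
    using f'.add[of "a *\<^sub>R (1, 0)" "b *\<^sub>R (0, 1)"] unfolding f'.scaleR by simp
  have "f' = (\<lambda>(a, b). a * partial_t f z + b * partial_x f z)"
    unfolding t x by (rule ext, clarify, rule ab)
  then show ?thesis
    using f' by simp
qed

text \<open>Directions (1, 0) and (0, 1) give the partial derivatives; direction (1, m) serves the
  lines along which \<open>\<mu>\<close> is followed.\<close>

lemma C_1_DERIV_line:
  assumes "C_k 1 f"
  shows "((\<lambda>s. f (t + a * s, x + b * s)) has_real_derivative
    a * partial_t f (t + a * s, x + b * s) + b * partial_x f (t + a * s, x + b * s)) (at s)"
proof -
  have "((\<lambda>s. (t + a * s, x + b * s)) has_derivative (\<lambda>h. (a * h, b * h))) (at s)"
    by (auto intro!: derivative_eq_intros)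
  from has_derivative_compose[OF this C_1_has_derivative[OF assms]]
  have "((\<lambda>s. f (t + a * s, x + b * s)) has_derivative
      (\<lambda>h. a * h * partial_t f (t + a * s, x + b * s) + b * h * partial_x f (t + a * s, x + b * s))) (at s)"
    by simp
  moreover have "(\<lambda>h. a * h * p + b * h * q) = (*) (a * p + b * q)" for p q
    by (simp add: fun_eq_iff distrib_right mult.assoc mult.commute[of p] mult.commute[of q])
  ultimately show ?thesis
    by (simp only: has_field_derivative_def)
qed

lemma C_1_continuous:
  assumes "C_k 1 f"
  shows "continuous_on UNIV f" "continuous_on UNIV (partial_t f)" "continuous_on UNIV (partial_x f)"
  using assms by (simp_all add: differentiable_imp_continuous_on del: split_paired_All)

section \<open>Real polynomials over the complex numbers, and coefficients of
  \<open>F_poly\<close>\<close>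

lemma pderiv_map_poly_of_real:
  "pderiv (map_poly complex_of_real p) = map_poly complex_of_real (pderiv p)"
  by (rule poly_eqI) (simp add: coeff_pderiv coeff_map_poly)

lemma higher_pderiv_map_poly_of_real:
  "(pderiv ^^ i) (map_poly complex_of_real p) = map_poly complex_of_real ((pderiv ^^ i) p)"
  by (induction i) (simp_all add: pderiv_map_poly_of_real)

lemma poly_map_poly_of_real:
  "poly (map_poly complex_of_real p) (complex_of_real x) = complex_of_real (poly p x)"
  by (induction p) (simp_all add: map_poly_pCons)

lemma poly_map_poly_of_real_cnj:
  "poly (map_poly complex_of_real p) (cnj w) = cnj (poly (map_poly complex_of_real p) w)"
  by (induction p) (simp_all add: map_poly_pCons)

lemma continuous_on_poly_family:
  fixes p :: "'a :: topological_space \<Rightarrow> 'b :: real_normed_field poly"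
  assumes "\<And>z. Polynomial.degree (p z) \<le> N"
    and "\<And>j. continuous_on A (\<lambda>z. Polynomial.coeff (p z) j)" and "continuous_on A \<xi>"
  shows "continuous_on A (\<lambda>z. poly (p z) (\<xi> z))"
  unfolding poly_eq_sum_atMost[OF assms(1)] by (intro continuous_intros assms(2,3))

lemma coeff_sum_monom_rev:
  fixes v :: "nat \<Rightarrow> 'a :: comm_monoid_add"
  shows "Polynomial.coeff (\<Sum>k = 1..n. Polynomial.monom (v k) (n - k)) j
    = (if j < n then v (n - j) else 0)"
proof (cases "j < n")
  case True
  have "Polynomial.coeff (\<Sum>k = 1..n. Polynomial.monom (v k) (n - k)) j
      = (\<Sum>k = 1..n. Polynomial.coeff (Polynomial.monom (v k) (n - k)) j)"
    unfolding coeff_sum by simp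
  also have "\<dots> = (\<Sum>k = 1..n. if k = n - j then v k else 0)"
    by (rule sum.cong) (use True in auto)
  finally show ?thesis
    using True by (subst (asm) sum.delta) auto
next
  case False
  then have "n - k \<noteq> j" if "k \<in> {1..n}" for k
    using that by auto
  then show ?thesis
    unfolding coeff_sum using False by simp
qed

lemma coeff_F_poly:
  "Polynomial.coeff (F_poly n v) j
    = (if j = n + 1 then 1 / (real n + 1) else if j < n then v (n - j) else 0)"
  unfolding F_poly_def coeff_add coeff_sum_monom_rev by simp

text \<open>Leibniz rule: only two terms survive because the second derivative of the linear factor
  is 0. At the point \<open>m\<close> the first of them vanishes.\<close>

lemma higher_pderiv_linear_mult:
  fixes q :: "'a :: idom poly"
  shows "(pderiv ^^ Suc i) ([:- m, 1:] * q)
    = [:- m, 1:] * (pderiv ^^ Suc i) q + Polynomial.smult (of_nat (Suc i)) ((pderiv ^^ i) q)"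
proof (induction i)
  case 0
  show ?case
    by (simp only: funpow_simps_right comp_def funpow_0 pderiv_mult) (simp add: pderiv_pCons)
next
  case (Suc i)
  have "(pderiv ^^ Suc (Suc i)) ([:- m, 1:] * q)
      = pderiv ([:- m, 1:] * (pderiv ^^ Suc i) q + Polynomial.smult (of_nat (Suc i)) ((pderiv ^^ i) q))"
    unfolding Suc[symmetric] by simp
  also have "\<dots> = [:- m, 1:] * (pderiv ^^ Suc (Suc i)) q + (pderiv ^^ Suc i) q
      + Polynomial.smult (of_nat (Suc i)) ((pderiv ^^ Suc i) q)"
    unfolding pderiv_add pderiv_mult pderiv_smult by (simp add: pderiv_pCons del: mult_pCons_left)
  also have "\<dots> = [:- m, 1:] * (pderiv ^^ Suc (Suc i)) q
      + Polynomial.smult (of_nat (Suc (Suc i))) ((pderiv ^^ Suc i) q)"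
    by (simp only: of_nat_Suc[of "Suc i"] smult_add_left smult_1_left add.assoc)
  finally show ?case .
qed

text \<open>Each non-real conjugate pair contributes exactly one root to the upper half plane,
  whichever of the two is called \<open>a i\<close>.\<close>

lemma filter_upper_proots_conjugate_pairs:
  assumes "finite I" "\<And>i. i \<in> I \<Longrightarrow> a i \<notin> \<real>"
  shows "filter_mset (\<lambda>w. Im w > 0) (proots (\<Prod>i\<in>I. [:- a i, 1:] * [:- cnj (a i), 1:]))
    = image_mset (\<lambda>i. Complex (Re (a i)) \<bar>Im (a i)\<bar>) (mset_set I)"
  using assms
proof induction
  case (insert i I)
  have nz: "(\<Prod>i\<in>I. [:- a i, 1:] * [:- cnj (a i), 1:]) \<noteq> 0"
    using insert.hyps by (subst prod_zero_iff) (auto simp del: mult_pCons_left)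
  have lin: "[:- w, 1:] * [:- cnj w, 1:] \<noteq> (0 :: complex poly)" for w
    by (simp del: mult_pCons_left)
  have "proots (\<Prod>i\<in>insert i I. [:- a i, 1:] * [:- cnj (a i), 1:])
      = {#a i, cnj (a i)#} + proots (\<Prod>i\<in>I. [:- a i, 1:] * [:- cnj (a i), 1:])"
    unfolding prod.insert[OF insert.hyps]
    by (subst proots_mult[OF lin nz], subst proots_mult) simp_all
  moreover have "filter_mset (\<lambda>w. Im w > 0) {#a i, cnj (a i)#} = {#Complex (Re (a i)) \<bar>Im (a i)\<bar>#}"
    using insert.prems[of i] by (auto simp: complex_is_Real_iff complex_eq_iff)
  moreover have "filter_mset (\<lambda>w. Im w > 0) (proots (\<Prod>i\<in>I. [:- a i, 1:] * [:- cnj (a i), 1:]))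
      = image_mset (\<lambda>i. Complex (Re (a i)) \<bar>Im (a i)\<bar>) (mset_set I)"
    by (rule insert.IH) (simp add: insert.prems)
  ultimately show ?case
    using insert.hyps by (simp only: filter_union_mset mset_set.insert) simp
qed simp

lemma map_poly_of_real_linear_mult:
  "map_poly complex_of_real ([:- c, 1:] * p) = [:- complex_of_real c, 1:] * map_poly complex_of_real p"
  by (rule poly_eqI) (simp add: coeff_map_poly coeff_pCons split: nat.split)

lemma map_poly_of_real_inject:
  "map_poly complex_of_real p = map_poly complex_of_real q \<longleftrightarrow> p = q"
  by (auto simp: poly_eq_iff coeff_map_poly)

subsection \<open>The factorized system\<close>

locale factorized_system =
  fixes l n :: nat
    and u :: "nat \<Rightarrow> real \<times> real \<Rightarrow> real"
    and \<mu> :: "real \<times> real \<Rightarrow> real"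
    and lam :: "nat \<Rightarrow> real \<times> real \<Rightarrow> complex"
  assumes n: "n = 2 * l + 1"
    and C1: "\<And>k. k \<in> {1..n} \<Longrightarrow> C_k 1 (u k)"
    and periodic: "periodic_t n u" "periodic_x n u"
    and system: "solves_system n u"
    and mu_cont: "continuous_on UNIV \<mu>"
    and lam_cont: "\<And>i. i \<in> {1..l} \<Longrightarrow> continuous_on UNIV (lam i)"
    and lam_nonreal: "\<And>i z. i \<in> {1..l} \<Longrightarrow> lam i z \<notin> \<real>"
    and factorization: "\<And>z. map_poly complex_of_real (pderiv (F_poly n (\<lambda>k. u k z))) =
      [:- complex_of_real (\<mu> z), 1:] * (\<Prod>i = 1..l. [:- lam i z, 1:] * [:- cnj (lam i z), 1:])"
begin

section \<open>The polynomial F, its partial derivatives, and the system as a polynomial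
  identity\<close>

abbreviation F :: "real \<times> real \<Rightarrow> real poly" where
  "F z \<equiv> F_poly n (\<lambda>k. u k z)"

text \<open>The derivative of \<open>F\<close> in \<open>t\<close> with the polynomial variable
  fixed; the leading coefficient of \<open>F\<close> is constant and contributes nothing. The same
  holds for \<open>Fx\<close>.\<close>

definition Ft :: "real \<times> real \<Rightarrow> real poly" where
  "Ft z = (\<Sum>k = 1..n. Polynomial.monom (partial_t (u k) z) (n - k))"

definition Fx :: "real \<times> real \<Rightarrow> real poly" where
  "Fx z = (\<Sum>k = 1..n. Polynomial.monom (partial_x (u k) z) (n - k))"

abbreviation cpoly :: "real poly \<Rightarrow> complex \<Rightarrow> complex" where
  "cpoly p \<equiv> poly (map_poly complex_of_real p)"

lemma coeff_Ft: "Polynomial.coeff (Ft z) j = (if j < n then partial_t (u (n - j)) z else 0)"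
  unfolding Ft_def coeff_sum_monom_rev ..

lemma coeff_Fx: "Polynomial.coeff (Fx z) j = (if j < n then partial_x (u (n - j)) z else 0)"
  unfolding Fx_def coeff_sum_monom_rev ..

lemma degree_Ft: "Polynomial.degree (Ft z) \<le> n - 1" and degree_Fx: "Polynomial.degree (Fx z) \<le> n - 1"
  by (auto intro!: degree_le simp: coeff_Ft coeff_Fx)

lemma degree_F: "Polynomial.degree (F z) \<le> n + 1"
  by (auto intro!: degree_le simp: coeff_F_poly)

text \<open>The coefficient of degree \<open>n - k\<close> is the \<open>k\<close>-th equation of
  the system; the conventions for \<open>u\<close> at the indices 0 and n + 1 match the missing term
  of degree \<open>n\<close> in \<open>F\<close> and the missing shifted term in degree 0.\<close>

lemma system_poly: "Ft z + [:0, 1:] * Fx z = Polynomial.smult (partial_x (u 1) z) (pderiv (F z))"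
proof (rule poly_eqI)
  fix j
  have pX: "Polynomial.coeff ([:0, 1:] * Fx z) j = (if j = 0 then 0 else Polynomial.coeff (Fx z) (j - 1))"
    by (cases j) (auto simp: coeff_pCons)
  show "Polynomial.coeff (Ft z + [:0, 1:] * Fx z) j
      = Polynomial.coeff (Polynomial.smult (partial_x (u 1) z) (pderiv (F z))) j"
  proof (cases "j < n")
    case True
    define k where "k = n - j"
    have k: "k \<in> {1..n}" "j = n - k"
      using True by (auto simp: k_def)
    have "partial_t (u k) z + (if k = n then 0 else partial_x (u (k + 1)) z)
       - (real n + 1 - real k) * (if k = 1 then 0 else u (k - 1) z) * partial_x (u 1) z = 0"
      using system k unfolding solves_system_components by blast
    moreover have "n - (j - 1) = k + 1" if "j \<noteq> 0"
      using that k by auto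
    moreover have "n - Suc j = k - 1" "real n + 1 - real k = real (Suc j)" "Suc j < n \<longleftrightarrow> k \<noteq> 1"
      "j = 0 \<longleftrightarrow> k = n" "j - 1 < n" "Suc j \<noteq> n + 1"
      using k by auto
    ultimately show ?thesis
      using True unfolding coeff_add pX coeff_smult coeff_pderiv coeff_F_poly coeff_Ft coeff_Fx
      by (auto simp: k_def[symmetric] split: if_splits)
  next
    case False
    show ?thesis
    \<comment> \<open>In degree \<open>n\<close> both sides are \<open>partial_x (u 1) z\<close>:
      the factor \<open>n + 1\<close> from differentiation cancels the normalisation of the leading
      coefficient.\<close>
    proof (cases "j = n")
      case True
      then show ?thesis
        using n unfolding coeff_add pX coeff_smult coeff_pderiv coeff_F_poly coeff_Ft coeff_Fx
        by (simp add: field_simps)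
    next
      case False
      then show ?thesis
        using \<open>\<not> j < n\<close> unfolding coeff_add pX coeff_smult coeff_pderiv coeff_F_poly coeff_Ft coeff_Fx
        by auto
    qed
  qed
qed

lemma has_coeff_derivative_line:
  "has_coeff_derivative (\<lambda>s. map_poly complex_of_real (F (t + a * s, x + b * s)))
    (map_poly complex_of_real (Polynomial.smult a (Ft (t + a * s, x + b * s))
      + Polynomial.smult b (Fx (t + a * s, x + b * s)))) s"
  unfolding has_coeff_derivative_def
proof (intro conjI allI)
  show "\<exists>N. \<forall>s. Polynomial.degree (map_poly complex_of_real (F (t + a * s, x + b * s))) \<le> N"
    using degree_F by auto
  fix j
  have "((\<lambda>s. Polynomial.coeff (F (t + a * s, x + b * s)) j) has_real_derivative
      (if j < n then a * partial_t (u (n - j)) (t + a * s, x + b * s)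
        + b * partial_x (u (n - j)) (t + a * s, x + b * s) else 0)) (at s)"
    unfolding coeff_F_poly
  proof (cases "j < n")
    case True
    then have "C_k 1 (u (n - j))"
      by (intro C1) auto
    then show "((\<lambda>s. if j = n + 1 then 1 / (real n + 1) else if j < n then u (n - j) (t + a * s, x + b * s) else 0)
      has_real_derivative (if j < n then a * partial_t (u (n - j)) (t + a * s, x + b * s)
        + b * partial_x (u (n - j)) (t + a * s, x + b * s) else 0)) (at s)"
      using True C_1_DERIV_line by simp
  next
    case False
    then have "(\<lambda>s. if j = n + 1 then 1 / (real n + 1) else if j < n then u (n - j) (t + a * s, x + b * s) else 0)
        = (\<lambda>s. if j = n + 1 then 1 / (real n + 1) else 0)"
      by simp
    then show "((\<lambda>s. if j = n + 1 then 1 / (real n + 1) else if j < n then u (n - j) (t + a * s, x + b * s) else 0)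
      has_real_derivative (if j < n then a * partial_t (u (n - j)) (t + a * s, x + b * s)
        + b * partial_x (u (n - j)) (t + a * s, x + b * s) else 0)) (at s)"
      using False by (simp only: DERIV_const if_False)
  qed
  from has_vector_derivative_of_real[OF this]
  have "((\<lambda>s. complex_of_real (Polynomial.coeff (F (t + a * s, x + b * s)) j)) has_vector_derivative
      complex_of_real (if j < n then a * partial_t (u (n - j)) (t + a * s, x + b * s)
        + b * partial_x (u (n - j)) (t + a * s, x + b * s) else 0)) (at s)" .
  moreover have "Polynomial.coeff (Polynomial.smult a (Ft (t + a * s, x + b * s))
        + Polynomial.smult b (Fx (t + a * s, x + b * s))) j
      = (if j < n then a * partial_t (u (n - j)) (t + a * s, x + b * s)
        + b * partial_x (u (n - j)) (t + a * s, x + b * s) else 0)"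
    unfolding coeff_add coeff_smult coeff_Ft coeff_Fx by simp
  ultimately show "((\<lambda>s. Polynomial.coeff (map_poly complex_of_real (F (t + a * s, x + b * s))) j)
      has_vector_derivative Polynomial.coeff (map_poly complex_of_real
        (Polynomial.smult a (Ft (t + a * s, x + b * s))
        + Polynomial.smult b (Fx (t + a * s, x + b * s)))) j) (at s)"
    by (simp only: coeff_map_poly[of complex_of_real, OF of_real_0])
qed

lemma has_coeff_derivative_t:
  "has_coeff_derivative (\<lambda>s. map_poly complex_of_real (F (s, x))) (map_poly complex_of_real (Ft (t, x))) t"
  using has_coeff_derivative_line[of 0 1 x 0 t] by simp

lemma has_coeff_derivative_x:
  "has_coeff_derivative (\<lambda>y. map_poly complex_of_real (F (t, y))) (map_poly complex_of_real (Fx (t, x))) x"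
  using has_coeff_derivative_line[of t 0 0 1 x] by simp

lemma pderiv_F_nonzero: "pderiv (F z) \<noteq> 0"
proof -
  have "Polynomial.coeff (pderiv (F z)) n \<noteq> 0"
    unfolding coeff_pderiv coeff_F_poly by simp
  then show ?thesis
    by auto
qed

lemma continuous_coeff:
  "continuous_on UNIV (\<lambda>z. Polynomial.coeff (F z) j)"
  "continuous_on UNIV (\<lambda>z. Polynomial.coeff (Ft z) j)"
  "continuous_on UNIV (\<lambda>z. Polynomial.coeff (Fx z) j)"
proof -
  have if_cont: "continuous_on UNIV (\<lambda>z :: real \<times> real. if P then f z else g z)"
    if "P \<Longrightarrow> continuous_on UNIV f" "\<not> P \<Longrightarrow> continuous_on UNIV g" for P and f g :: "real \<times> real \<Rightarrow> real"
    using that by (cases P) simp_all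
  have ck: "continuous_on UNIV (u (n - j))" "continuous_on UNIV (partial_t (u (n - j)))"
    "continuous_on UNIV (partial_x (u (n - j)))" if "j < n"
    using C_1_continuous[OF C1[of "n - j"]] that by auto
  show "continuous_on UNIV (\<lambda>z. Polynomial.coeff (F z) j)"
    "continuous_on UNIV (\<lambda>z. Polynomial.coeff (Ft z) j)"
    "continuous_on UNIV (\<lambda>z. Polynomial.coeff (Fx z) j)"
    unfolding coeff_F_poly coeff_Ft coeff_Fx by (intro if_cont continuous_on_const ck; assumption)+
qed

lemma continuous_cpoly:
  assumes "continuous_on UNIV \<xi>"
  shows "continuous_on UNIV (\<lambda>z. cpoly (F z) (\<xi> z))"
    "continuous_on UNIV (\<lambda>z. cpoly (Ft z) (\<xi> z))"
    "continuous_on UNIV (\<lambda>z. cpoly (Fx z) (\<xi> z))"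
proof -
  have *: "continuous_on UNIV (\<lambda>z. cpoly (p z) (\<xi> z))"
    if "\<And>z. Polynomial.degree (p z) \<le> N" "\<And>j. continuous_on UNIV (\<lambda>z. Polynomial.coeff (p z) j)" for p N
  proof (rule continuous_on_poly_family[OF _ _ assms])
    show "Polynomial.degree (map_poly complex_of_real (p z)) \<le> N" for z
      using that(1) by simp
    show "continuous_on UNIV (\<lambda>z. Polynomial.coeff (map_poly complex_of_real (p z)) j)" for j
      using that(2) by (simp add: coeff_map_poly continuous_on_of_real)
  qed
  show "continuous_on UNIV (\<lambda>z. cpoly (F z) (\<xi> z))" "continuous_on UNIV (\<lambda>z. cpoly (Ft z) (\<xi> z))"
    "continuous_on UNIV (\<lambda>z. cpoly (Fx z) (\<xi> z))"
    by (rule *[OF degree_F continuous_coeff(1)] *[OF degree_Ft continuous_coeff(2)]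
        *[OF degree_Fx continuous_coeff(3)])+
qed

section \<open>Roots in the upper half plane and their critical values\<close>

text \<open>
  Which of \<open>lam i\<close> and its conjugate lies in the upper half plane is irrelevant, but the multiset
  of roots in the upper half plane depends only on \<open>F z\<close>. Hence sums over \<open>upper i\<close> are periodic
  although the individual roots are not.
\<close>

definition upper :: "nat \<Rightarrow> real \<times> real \<Rightarrow> complex" where
  "upper i z = Complex (Re (lam i z)) \<bar>Im (lam i z)\<bar>"

lemma upper_cont: "i \<in> {1..l} \<Longrightarrow> continuous_on UNIV (upper i)"
  unfolding upper_def by (intro continuous_intros lam_cont)

lemma Im_upper: "i \<in> {1..l} \<Longrightarrow> Im (upper i z) > 0"
  using lam_nonreal[of i z] by (auto simp: upper_def complex_is_Real_iff)

lemma critical_lam: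
  assumes "i \<in> {1..l}"
  shows "cpoly (pderiv (F z)) (lam i z) = 0" "cpoly (pderiv (F z)) (cnj (lam i z)) = 0"
proof -
  show *: "cpoly (pderiv (F z)) (lam i z) = 0"
  proof -
    have "(\<Prod>j = 1..l. poly ([:- lam j z, 1:] * [:- cnj (lam j z), 1:]) (lam i z)) = 0"
      by (rule prod_zero) (use assms in \<open>auto intro!: bexI[of _ i]\<close>)
    then show ?thesis
      unfolding factorization poly_mult[of "[:- complex_of_real (\<mu> z), 1:]"] poly_prod by simp
  qed
  show "cpoly (pderiv (F z)) (cnj (lam i z)) = 0"
    unfolding poly_map_poly_of_real_cnj * by simp
qed

lemma upper_cases: "upper i z = lam i z \<or> upper i z = cnj (lam i z)"
  by (auto simp: upper_def complex_eq_iff)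

lemma critical_upper: "i \<in> {1..l} \<Longrightarrow> cpoly (pderiv (F z)) (upper i z) = 0"
  using upper_cases[of i z] critical_lam by metis

text \<open>At a root of \<open>pderiv (F z)\<close> the right-hand side of
  \<open>system_poly\<close> drops out.\<close>

lemma critical_system:
  assumes "cpoly (pderiv (F z)) w = 0"
  shows "cpoly (Ft z) w = - w * cpoly (Fx z) w"
proof -
  have "map_poly complex_of_real (Ft z) + [:0, 1:] * map_poly complex_of_real (Fx z)
      = map_poly complex_of_real (Ft z + [:0, 1:] * Fx z)"
    by (rule poly_eqI) (simp add: coeff_map_poly coeff_pCons split: nat.split)
  also have "\<dots> = Polynomial.smult (of_real (partial_x (u 1) z)) (map_poly complex_of_real (pderiv (F z)))"
    unfolding system_poly by (rule poly_eqI) (simp add: coeff_map_poly)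
  finally have "poly (map_poly complex_of_real (Ft z) + [:0, 1:] * map_poly complex_of_real (Fx z)) w
      = poly (Polynomial.smult (of_real (partial_x (u 1) z)) (map_poly complex_of_real (pderiv (F z)))) w"
    by (rule arg_cong)
  then have "cpoly (Ft z) w + w * cpoly (Fx z) w = 0"
    unfolding poly_add poly_mult poly_smult assms by simp
  then show ?thesis
    by (simp add: add_eq_0_iff2)
qed

lemma critical_value_derivatives:
  assumes i: "i \<in> {1..l}"
  shows "((\<lambda>s. cpoly (F (s, x)) (upper i (s, x))) has_vector_derivative
      cpoly (Ft (t, x)) (upper i (t, x))) (at t)"
    and "((\<lambda>y. cpoly (F (t, y)) (upper i (t, y))) has_vector_derivative
      cpoly (Fx (t, x)) (upper i (t, x))) (at x)"
proof -
  have nz: "pderiv (map_poly complex_of_real (F z)) \<noteq> 0" for z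
    using pderiv_F_nonzero[of z] unfolding pderiv_map_poly_of_real by simp
  have crit: "poly (pderiv (map_poly complex_of_real (F z))) (upper i z) = 0" for z
    unfolding pderiv_map_poly_of_real by (rule critical_upper[OF i])
  have "continuous_on UNIV (\<lambda>s. upper i (s, x))" "continuous_on UNIV (\<lambda>y. upper i (t, y))"
    by (intro continuous_on_compose2[OF upper_cont[OF i]] continuous_intros subset_UNIV)+
  then have "isCont (\<lambda>s. upper i (s, x)) t" "isCont (\<lambda>y. upper i (t, y)) x"
    by (simp_all add: continuous_on_eq_continuous_at)
  then show "((\<lambda>s. cpoly (F (s, x)) (upper i (s, x))) has_vector_derivative
      cpoly (Ft (t, x)) (upper i (t, x))) (at t)"
    and "((\<lambda>y. cpoly (F (t, y)) (upper i (t, y))) has_vector_derivative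
      cpoly (Fx (t, x)) (upper i (t, x))) (at x)"
    using critical_value_has_vector_derivative[OF has_coeff_derivative_t _ crit nz]
      critical_value_has_vector_derivative[OF has_coeff_derivative_x _ crit nz] by blast+
qed

text \<open>Each conjugate pair has one member in the upper half plane and the real root is filtered
  out, so the sum no longer refers to the labelling of the roots.\<close>

lemma sum_upper_eq:
  "(\<Sum>i = 1..l. \<phi> (upper i z))
    = (\<Sum>w\<in>#filter_mset (\<lambda>w. Im w > 0) (proots (map_poly complex_of_real (pderiv (F z)))). \<phi> w)"
proof -
  have nz: "(\<Prod>i = 1..l. [:- lam i z, 1:] * [:- cnj (lam i z), 1:]) \<noteq> 0"
    by (subst prod_zero_iff) (auto simp del: mult_pCons_left)
  have "proots (map_poly complex_of_real (pderiv (F z)))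
      = {#complex_of_real (\<mu> z)#} + proots (\<Prod>i = 1..l. [:- lam i z, 1:] * [:- cnj (lam i z), 1:])"
    unfolding factorization by (subst proots_mult[OF _ nz]) simp_all
  then have "filter_mset (\<lambda>w. Im w > 0) (proots (map_poly complex_of_real (pderiv (F z))))
      = filter_mset (\<lambda>w. Im w > 0) (proots (\<Prod>i = 1..l. [:- lam i z, 1:] * [:- cnj (lam i z), 1:]))"
    by simp
  also have "\<dots> = image_mset (\<lambda>i. upper i z) (mset_set {1..l})"
    unfolding upper_def by (rule filter_upper_proots_conjugate_pairs) (use lam_nonreal in auto)
  finally show ?thesis
    by (simp add: sum_unfold_sum_mset image_mset.compositionality comp_def)
qed

lemma F_cong: "(\<And>k. k \<in> {1..n} \<Longrightarrow> u k z = u k z') \<Longrightarrow> F z = F z'"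
  unfolding F_poly_def by simp

text \<open>
  With \<open>r\<^sub>j = F (upper j)\<close>, the function \<open>\<Psi> t = \<Sum>\<^sub>j \<integral> Re r\<^sub>j * Im (r\<^sub>j)\<^sub>x dx\<close>
  over one period in \<open>x\<close> is periodic, and its derivative
  \<open>\<Sum>\<^sub>j \<integral> Im (upper j) * |(r\<^sub>j)\<^sub>x|\<^sup>2 dx\<close> is nonnegative; so it vanishes.
\<close>

lemma Fx_vanishes_at_upper:
  assumes T: "T > 0" "\<And>k t x. k \<in> {1..n} \<Longrightarrow> u k (t + T, x) = u k (t, x)"
    and X: "X > 0" "\<And>k t x. k \<in> {1..n} \<Longrightarrow> u k (t, x + X) = u k (t, x)"
    and i: "i \<in> {1..l}"
  shows "cpoly (Fx (t, a)) (upper i (t, a)) = 0"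
proof -
  define f where "f i z = Re (cpoly (F z) (upper i z))" for i z
  define g where "g i z = Im (cpoly (F z) (upper i z))" for i z
  define ft where "ft i z = Re (cpoly (Ft z) (upper i z))" for i z
  define fx where "fx i z = Re (cpoly (Fx z) (upper i z))" for i z
  define gt where "gt i z = Im (cpoly (Ft z) (upper i z))" for i z
  define gx where "gx i z = Im (cpoly (Fx z) (upper i z))" for i z
  have deriv: "((\<lambda>s. f j (s, x)) has_real_derivative ft j (t, x)) (at t)"
      "((\<lambda>y. f j (t, y)) has_real_derivative fx j (t, x)) (at x)"
      "((\<lambda>s. g j (s, x)) has_real_derivative gt j (t, x)) (at t)"
      "((\<lambda>y. g j (t, y)) has_real_derivative gx j (t, x)) (at x)" if "j \<in> {1..l}" for j t x
    unfolding f_def g_def ft_def fx_def gt_def gx_def has_real_derivative_iff_has_vector_derivative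
    by (intro bounded_linear.has_vector_derivative[OF bounded_linear_Re]
        bounded_linear.has_vector_derivative[OF bounded_linear_Im] critical_value_derivatives that)+
  have cont: "continuous_on UNIV (f j)" "continuous_on UNIV (g j)" "continuous_on UNIV (ft j)"
      "continuous_on UNIV (fx j)" "continuous_on UNIV (gt j)" "continuous_on UNIV (gx j)"
    if "j \<in> {1..l}" for j
    unfolding f_def[abs_def] g_def[abs_def] ft_def[abs_def] fx_def[abs_def] gt_def[abs_def] gx_def[abs_def]
    by (intro continuous_on_Re continuous_on_Im continuous_cpoly upper_cont that)+
  define J where "J j z = Im (upper j z) * (cmod (cpoly (Fx z) (upper j z)))\<^sup>2" for j z
  \<comment> \<open>By \<open>critical_system\<close>, F_t = - \<lambda> F_x at the root \<lambda> =
    \<open>upper j z\<close>; for a complex w, Re (- \<lambda> w) Im w - Re w Im (- \<lambda> w) =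
    Im \<lambda> |w|^2.\<close>
  have J: "ft j z * gx j z - fx j z * gt j z = J j z" if "j \<in> {1..l}" for j z
    unfolding ft_def gt_def fx_def gx_def J_def critical_system[OF critical_upper[OF that]] cmod_power2
    by (simp add: algebra_simps power2_eq_square)
  have J_nonneg: "J j z \<ge> 0" if "j \<in> {1..l}" for j z
    using Im_upper[OF that, of z] by (simp add: J_def)
  have J_cont: "continuous_on UNIV (\<lambda>x. J j (t, x))" if "j \<in> {1..l}" for j t
    unfolding J_def
    by (intro continuous_intros continuous_on_compose2[OF upper_cont[OF that]]
        continuous_on_compose2[OF continuous_cpoly(3)[OF upper_cont[OF that]]] subset_UNIV)
  define \<Psi> where "\<Psi> t = (\<Sum>j = 1..l. integral {a..a + X} (\<lambda>x. f j (t, x) * gx j (t, x)))" for t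
  define \<Psi>' where "\<Psi>' t = (\<Sum>j = 1..l. integral {a..a + X} (\<lambda>x. J j (t, x)))" for t
  have FX: "F (t, x + X) = F (t, x)" "Ft (t, x + X) = Ft (t, x)" for t x
  proof -
    show "F (t, x + X) = F (t, x)"
      using X(2) by (rule F_cong)
    have "partial_t (u k) (t, x + X) = partial_t (u k) (t, x)" if "k \<in> {1..n}" for k
      unfolding partial_t_def using X(2)[OF that] by simp
    then show "Ft (t, x + X) = Ft (t, x)"
      unfolding Ft_def by simp
  qed
  have FT: "F (t + T, x) = F (t, x)" "Fx (t + T, x) = Fx (t, x)" for t x
  proof -
    show "F (t + T, x) = F (t, x)"
      using T(2) by (rule F_cong)
    have "partial_x (u k) (t + T, x) = partial_x (u k) (t, x)" if "k \<in> {1..n}" for k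
      unfolding partial_x_def using T(2)[OF that] by simp
    then show "Fx (t + T, x) = Fx (t, x)"
      unfolding Fx_def by simp
  qed
  have "(\<Psi> has_real_derivative (\<Sum>j = 1..l. integral {a..a + X} (\<lambda>x. J j (t, x))
      + (f j (t, a + X) * gt j (t, a + X) - f j (t, a) * gt j (t, a)))) (at t)" for t
    unfolding \<Psi>_def[abs_def]
  proof (intro DERIV_sum)
    fix j assume j: "j \<in> {1..l}"
    show "((\<lambda>t. integral {a..a + X} (\<lambda>x. f j (t, x) * gx j (t, x))) has_real_derivative
        integral {a..a + X} (\<lambda>x. J j (t, x))
        + (f j (t, a + X) * gt j (t, a + X) - f j (t, a) * gt j (t, a))) (at t)"
      unfolding J[OF j, symmetric]
      by (rule DERIV_integral_mult_partial[OF deriv[OF j] cont[OF j]]) (use X in simp)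
  qed
  \<comment> \<open>The boundary terms cancel only after summation, since translation by a period
    may permute the roots. The function \<open>\<phi>\<close> itself depends on \<open>z\<close>,
    but only through \<open>F z\<close> and \<open>Ft z\<close>, which are periodic in
    \<open>x\<close>.\<close>
  moreover have "(\<Sum>j = 1..l. f j (t, a + X) * gt j (t, a + X)) = (\<Sum>j = 1..l. f j (t, a) * gt j (t, a))" for t
    unfolding f_def gt_def sum_upper_eq[where \<phi> = "\<lambda>w. Re (cpoly (F z) w) * Im (cpoly (Ft z) w)" and z = z for z]
    by (simp only: FX)
  ultimately have \<Psi>_deriv: "(\<Psi> has_real_derivative \<Psi>' t) (at t)" for t
    by (simp add: \<Psi>'_def sum.distrib sum_subtractf)
  have \<Psi>'_nonneg: "\<Psi>' t \<ge> 0" for t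
    unfolding \<Psi>'_def
    by (intro sum_nonneg integral_nonneg J_nonneg integrable_continuous_interval
        continuous_on_subset[OF J_cont]) auto
  have \<Psi>_per: "\<Psi> (t + T) = \<Psi> t" for t
  proof -
    have swap: "\<Psi> t = integral {a..a + X} (\<lambda>x. \<Sum>j = 1..l. f j (t, x) * gx j (t, x))" for t
      unfolding \<Psi>_def
      by (intro integral_sum[symmetric] integrable_continuous_interval continuous_intros
          continuous_on_compose2[OF cont(1)] continuous_on_compose2[OF cont(6)]) auto
    have "(\<Sum>j = 1..l. f j (t + T, x) * gx j (t + T, x)) = (\<Sum>j = 1..l. f j (t, x) * gx j (t, x))" for x
      unfolding f_def gx_def sum_upper_eq[where \<phi> = "\<lambda>w. Re (cpoly (F z) w) * Im (cpoly (Fx z) w)" and z = z for z]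
      by (simp only: FT)
    then show ?thesis
      unfolding swap by simp
  qed
  have mono: "\<Psi> s \<le> \<Psi> t" if "s \<le> t" for s t
    using DERIV_nonneg_imp_nondecreasing[OF that, of \<Psi>] \<Psi>_deriv \<Psi>'_nonneg by blast
  \<comment> \<open>Near \<open>t\<close> the monotone function \<open>\<Psi>\<close> lies between
    its values at \<open>t - T\<close> and \<open>t + T\<close>, both equal to
    \<open>\<Psi> t\<close>; so it is locally constant.\<close>
  have "\<Psi>' t = 0"
  proof (rule DERIV_local_const[OF \<Psi>_deriv T(1)], intro allI impI)
    fix s assume "\<bar>t - s\<bar> < T"
    then have "\<Psi> (t - T) \<le> \<Psi> s" "\<Psi> s \<le> \<Psi> (t + T)"
      by (auto intro: mono)
    then show "\<Psi> t = \<Psi> s"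
      using \<Psi>_per[of t] \<Psi>_per[of "t - T"] by simp
  qed
  then have "integral {a..a + X} (\<lambda>x. J i (t, x)) = 0"
    unfolding \<Psi>'_def using i
    by (subst (asm) sum_nonneg_eq_0_iff)
      (auto intro!: integral_nonneg J_nonneg integrable_continuous_interval continuous_on_subset[OF J_cont])
  \<comment> \<open>A continuous nonnegative function with integral 0 vanishes throughout the
    interval, in particular at its left end \<open>a\<close>, which is arbitrary.\<close>
  then have "J i (t, a) = 0"
    using X(1) J_nonneg[OF i] continuous_on_subset[OF J_cont[OF i]]
    by (subst (asm) integral_eq_0_iff) auto
  then show ?thesis
    using Im_upper[OF i, of "(t, a)"] by (simp add: J_def)
qed

section \<open>Divisibility of the partial derivatives of F by the non-real factors\<close>

lemma Fx_root:
  assumes "i \<in> {1..l}"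
  shows "cpoly (Fx z) (lam i z) = 0" "cpoly (Fx z) (cnj (lam i z)) = 0"
proof -
  obtain T X where "T > 0" "\<And>k t x. k \<in> {1..n} \<Longrightarrow> u k (t + T, x) = u k (t, x)"
    "X > 0" "\<And>k t x. k \<in> {1..n} \<Longrightarrow> u k (t, x + X) = u k (t, x)"
    using periodic unfolding periodic_t_def periodic_x_def by blast
  then have "cpoly (Fx z) (upper i z) = 0"
    using Fx_vanishes_at_upper[OF _ _ _ _ assms, of T X "fst z" "snd z"] by simp
  then have "cpoly (Fx z) (lam i z) = 0 \<or> cpoly (Fx z) (cnj (lam i z)) = 0"
    using upper_cases[of i z] by auto
  then show "cpoly (Fx z) (lam i z) = 0" "cpoly (Fx z) (cnj (lam i z)) = 0"
    by (simp_all add: poly_map_poly_of_real_cnj)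
qed

text \<open>\<open>Fx z\<close> has degree at most \<open>n - 1 = 2 * l\<close> and vanishes at the
  \<open>2 * l\<close> non-real critical points. Applied at fixed \<open>t\<close>,
  \<open>eq_smult_prod_critical_points\<close> accounts for multiplicities; the constant factor is
  the coefficient of degree \<open>n - 1\<close>.\<close>

lemma Fx_eq: "[:- \<mu> z, 1:] * Fx z = Polynomial.smult (partial_x (u 1) z) (pderiv (F z))"
proof -
  obtain t x where z: "z = (t, x)"
    by (cases z)
  \<comment> \<open>The Boolean tells \<open>lam i\<close> from its conjugate, so that all non-real
    roots form one indexed family.\<close>
  define K :: "(nat \<times> bool) set" where "K = {1..l} \<times> UNIV"
  define \<rho> where "\<rho> k y = (if snd k then lam (fst k) (t, y) else cnj (lam (fst k) (t, y)))" for k y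
  have K: "finite K" "card K = n - 1"
    by (simp_all add: K_def n card_cartesian_product)
  have prod_K: "(\<Prod>k\<in>K. [:- \<rho> k y, 1:])
      = (\<Prod>i = 1..l. [:- lam i (t, y), 1:] * [:- cnj (lam i (t, y)), 1:])" for y
  proof -
    have "(\<Prod>k\<in>K. [:- \<rho> k y, 1:]) = (\<Prod>i = 1..l. \<Prod>b\<in>UNIV. [:- \<rho> (i, b) y, 1:])"
      unfolding K_def prod.cartesian_product by (rule prod.cong) auto
    also have "\<dots> = (\<Prod>i = 1..l. [:- lam i (t, y), 1:] * [:- cnj (lam i (t, y)), 1:])"
      by (rule prod.cong) (simp_all add: UNIV_bool \<rho>_def mult.commute del: mult_pCons_left mult_pCons_right)
    finally show ?thesis .
  qed
  have lam_cont': "continuous_on UNIV (\<lambda>y. lam i (t, y))" if "i \<in> {1..l}" for i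
    by (intro continuous_on_compose2[OF lam_cont[OF that]] continuous_intros subset_UNIV)
  have "map_poly complex_of_real (Fx (t, x))
      = Polynomial.smult (Polynomial.coeff (map_poly complex_of_real (Fx (t, x))) (card K)) (\<Prod>k\<in>K. [:- \<rho> k x, 1:])"
  proof (rule eq_smult_prod_critical_points[where P = "\<lambda>y. map_poly complex_of_real (F (t, y))"
        and \<nu> = "\<lambda>y. complex_of_real (\<mu> (t, y))"])
    show "has_coeff_derivative (\<lambda>y. map_poly complex_of_real (F (t, y)))
        (map_poly complex_of_real (Fx (t, y))) y" for y
      by (rule has_coeff_derivative_x)
    show "continuous_on UNIV (\<rho> k)" if "k \<in> K" for k
      using that lam_cont'[of "fst k"] continuous_on_cnj[OF lam_cont'[of "fst k"]]
      by (cases "snd k") (auto simp: K_def \<rho>_def[abs_def])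
    show "pderiv (map_poly complex_of_real (F (t, y)))
        = [:- complex_of_real (\<mu> (t, y)), 1:] * (\<Prod>k\<in>K. [:- \<rho> k y, 1:])" for y
      unfolding pderiv_map_poly_of_real prod_K by (rule factorization)
    show "\<rho> k y \<noteq> complex_of_real (\<mu> (t, y))" if "k \<in> K" for k y
      using that lam_nonreal[of "fst k" "(t, y)"]
      by (auto simp: K_def \<rho>_def complex_is_Real_iff complex_eq_iff)
    show "poly (map_poly complex_of_real (Fx (t, y))) (\<rho> k y) = 0" if "k \<in> K" for k y
      using that Fx_root[of "fst k" "(t, y)"] by (auto simp: K_def \<rho>_def)
    show "Polynomial.degree (map_poly complex_of_real (Fx (t, y))) \<le> card K" for y
      using degree_Fx[of "(t, y)"] by (simp add: K)
    show "continuous_on UNIV (\<lambda>y. Polynomial.coeff (map_poly complex_of_real (Fx (t, y))) j)" for j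
    proof -
      have "continuous_on UNIV (\<lambda>y. Polynomial.coeff (Fx (t, y)) j)"
        by (intro continuous_on_compose2[OF continuous_coeff(3)] continuous_intros subset_UNIV)
      then show ?thesis
        by (simp add: coeff_map_poly continuous_on_of_real)
    qed
  qed (rule K)
  moreover have "Polynomial.coeff (Fx (t, x)) (card K) = partial_x (u 1) (t, x)"
    unfolding coeff_Fx K using n by simp
  ultimately have Fx: "map_poly complex_of_real (Fx z) = Polynomial.smult (of_real (partial_x (u 1) z))
      (\<Prod>i = 1..l. [:- lam i z, 1:] * [:- cnj (lam i z), 1:])"
    unfolding z prod_K by (simp only: coeff_map_poly[of complex_of_real, OF of_real_0])
  have "map_poly complex_of_real ([:- \<mu> z, 1:] * Fx z)
      = Polynomial.smult (of_real (partial_x (u 1) z)) (map_poly complex_of_real (pderiv (F z)))"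
    unfolding map_poly_of_real_linear_mult Fx factorization mult_smult_right ..
  also have "\<dots> = map_poly complex_of_real (Polynomial.smult (partial_x (u 1) z) (pderiv (F z)))"
    by (rule poly_eqI) (simp add: coeff_map_poly)
  finally show ?thesis
    by (simp only: map_poly_of_real_inject)
qed

text \<open>\<open>system_poly\<close> and \<open>Fx_eq\<close> have the same right-hand side;
  equating their left-hand sides cancels the variable times \<open>Fx z\<close>.\<close>

lemma Ft_eq: "Ft z = Polynomial.smult (- \<mu> z) (Fx z)"
proof -
  have "Ft z + [:0, 1:] * Fx z = [:- \<mu> z, 1:] * Fx z"
    unfolding system_poly Fx_eq ..
  then show ?thesis
    by simp
qed

section \<open>Constancy of the real root and the final dichotomy\<close>

lemma mu_root: "poly (pderiv (F z)) (\<mu> z) = 0"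
proof -
  have "cpoly (pderiv (F z)) (of_real (\<mu> z)) = 0"
    unfolding factorization poly_mult[of "[:- complex_of_real (\<mu> z), 1:]"] by simp
  then show ?thesis
    by (simp add: poly_map_poly_of_real)
qed

text \<open>All other roots are non-real, so none of them equals \<open>\<mu> z\<close>.\<close>

lemma mu_simple: "poly (pderiv (pderiv (F z))) (\<mu> z) \<noteq> 0"
proof -
  define Q where "Q = (\<Prod>i = 1..l. [:- lam i z, 1:] * [:- cnj (lam i z), 1:])"
  have "poly Q (of_real (\<mu> z)) \<noteq> 0"
    using lam_nonreal[of _ z]
    unfolding Q_def poly_prod poly_mult
    by (subst prod_zero_iff) (auto simp: complex_is_Real_iff complex_eq_iff)
  moreover have "poly (pderiv ([:- complex_of_real (\<mu> z), 1:] * Q)) (of_real (\<mu> z)) = poly Q (of_real (\<mu> z))"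
    unfolding pderiv_mult by (simp add: pderiv_pCons)
  moreover have "cpoly (pderiv (pderiv (F z))) (of_real (\<mu> z))
      = poly (pderiv ([:- complex_of_real (\<mu> z), 1:] * Q)) (of_real (\<mu> z))"
    unfolding pderiv_map_poly_of_real[symmetric, of "pderiv (F z)"] factorization Q_def ..
  ultimately show ?thesis
    by (metis of_real_0 poly_map_poly_of_real)
qed

text \<open>Freeze m = \<open>\<mu> (t, x)\<close>. Along direction (1, m), \<open>Ft_eq\<close>
  gives F the derivative (m - \<mu>) F_x, so implicit differentiation at the simple root \<mu>
  yields a linear equation for \<mu> - m with initial value 0. This also establishes
  differentiability of \<mu> along the line.\<close>

lemma mu_const_on_line: "\<mu> (t + s, x + \<mu> (t, x) * s) = \<mu> (t, x)"
proof -
  define m where "m = \<mu> (t, x)"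
  define \<gamma> where "\<gamma> s = (t + 1 * s, x + m * s)" for s
  have \<gamma>: "continuous_on UNIV \<gamma>"
    unfolding \<gamma>_def by (intro continuous_intros)
  have \<mu>\<gamma>: "continuous_on UNIV (\<lambda>s. \<mu> (\<gamma> s))"
    by (intro continuous_on_compose2[OF mu_cont \<gamma>] subset_UNIV)
  define w where "w s = poly (pderiv (Fx (\<gamma> s))) (\<mu> (\<gamma> s)) / poly (pderiv (pderiv (F (\<gamma> s)))) (\<mu> (\<gamma> s))" for s
  have w: "continuous_on UNIV w"
  proof -
    have F: "continuous_on UNIV (\<lambda>s. Polynomial.coeff (F (\<gamma> s)) j)"
      and Fx: "continuous_on UNIV (\<lambda>s. Polynomial.coeff (Fx (\<gamma> s)) j)" for j
      by (intro continuous_on_compose2[OF continuous_coeff(1) \<gamma>] continuous_on_compose2[OF continuous_coeff(3) \<gamma>]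
          subset_UNIV)+
    have "continuous_on UNIV (\<lambda>s. poly (pderiv (Fx (\<gamma> s))) (\<mu> (\<gamma> s)))"
    proof (rule continuous_on_poly_family[OF _ _ \<mu>\<gamma>])
      show "Polynomial.degree (pderiv (Fx (\<gamma> s))) \<le> n" for s
        using degree_Fx[of "\<gamma> s"] by (simp add: degree_pderiv)
      show "continuous_on UNIV (\<lambda>s. Polynomial.coeff (pderiv (Fx (\<gamma> s))) j)" for j
        unfolding coeff_pderiv by (intro continuous_intros Fx)
    qed
    moreover have "continuous_on UNIV (\<lambda>s. poly (pderiv (pderiv (F (\<gamma> s)))) (\<mu> (\<gamma> s)))"
    proof (rule continuous_on_poly_family[OF _ _ \<mu>\<gamma>])
      show "Polynomial.degree (pderiv (pderiv (F (\<gamma> s)))) \<le> n" for s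
        using degree_F[of "\<gamma> s"] by (simp add: degree_pderiv)
      show "continuous_on UNIV (\<lambda>s. Polynomial.coeff (pderiv (pderiv (F (\<gamma> s)))) j)" for j
        unfolding coeff_pderiv by (intro continuous_intros F)
    qed
    ultimately show ?thesis
      unfolding w_def using mu_simple by (intro continuous_on_divide) auto
  qed
  have "((\<lambda>s. \<mu> (\<gamma> s) - m) has_real_derivative w s * (\<mu> (\<gamma> s) - m)) (at s)" for s
  proof -
    have dir: "Polynomial.smult 1 (Ft (\<gamma> s)) + Polynomial.smult m (Fx (\<gamma> s))
        = Polynomial.smult (m - \<mu> (\<gamma> s)) (Fx (\<gamma> s))"
      unfolding Ft_eq by (simp add: smult_diff_left)
    have "has_coeff_derivative (\<lambda>s. map_poly complex_of_real (F (\<gamma> s)))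
        (map_poly complex_of_real (Polynomial.smult (m - \<mu> (\<gamma> s)) (Fx (\<gamma> s)))) s"
      using has_coeff_derivative_line[of t 1 x m s] unfolding \<gamma>_def[symmetric] dir .
    then have "has_coeff_derivative (\<lambda>s. map_poly complex_of_real (pderiv (F (\<gamma> s))))
        (map_poly complex_of_real (pderiv (Polynomial.smult (m - \<mu> (\<gamma> s)) (Fx (\<gamma> s))))) s"
      unfolding pderiv_map_poly_of_real[symmetric] by (rule has_coeff_derivative_pderiv)
    then have "((\<lambda>s. complex_of_real (\<mu> (\<gamma> s))) has_vector_derivative
        - cpoly (pderiv (Polynomial.smult (m - \<mu> (\<gamma> s)) (Fx (\<gamma> s)))) (of_real (\<mu> (\<gamma> s)))
        / poly (pderiv (map_poly complex_of_real (pderiv (F (\<gamma> s))))) (of_real (\<mu> (\<gamma> s)))) (at s)"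
    proof (rule simple_root_has_vector_derivative)
      have "continuous_on UNIV (\<lambda>s. complex_of_real (\<mu> (\<gamma> s)))"
        by (rule continuous_on_of_real[OF \<mu>\<gamma>])
      then show "isCont (\<lambda>s. complex_of_real (\<mu> (\<gamma> s))) s"
        by (simp add: continuous_on_eq_continuous_at)
      show "\<forall>\<^sub>F r in nhds s. cpoly (pderiv (F (\<gamma> r))) (complex_of_real (\<mu> (\<gamma> r))) = 0"
        by (simp add: poly_map_poly_of_real mu_root)
      show "poly (pderiv (map_poly complex_of_real (pderiv (F (\<gamma> s))))) (of_real (\<mu> (\<gamma> s))) \<noteq> 0"
        by (simp add: pderiv_map_poly_of_real poly_map_poly_of_real mu_simple)
    qed
    then have "((\<lambda>s. complex_of_real (\<mu> (\<gamma> s))) has_vector_derivative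
        complex_of_real (w s * (\<mu> (\<gamma> s) - m))) (at s)"
      by (rule has_vector_derivative_eq_rhs)
        (simp add: pderiv_map_poly_of_real poly_map_poly_of_real pderiv_smult w_def
          diff_divide_distrib algebra_simps flip: of_real_minus of_real_mult of_real_divide of_real_diff)
    from bounded_linear.has_vector_derivative[OF bounded_linear_Re this]
    show ?thesis
      by (auto simp: has_real_derivative_iff_has_vector_derivative[symmetric] intro!: derivative_eq_intros)
  qed
  then have "\<mu> (\<gamma> s) - m = 0"
    by (rule linear_ode_zero[where a = 0]) (simp_all add: w \<gamma>_def m_def)
  then show ?thesis
    by (simp add: \<gamma>_def m_def)
qed

text \<open>The lines on which \<open>\<mu>\<close> is constant have slope \<open>\<mu>\<close>, so different values of \<open>\<mu>\<close> would
  be attained on lines that intersect.\<close>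

lemma mu_constant: "\<mu> z = \<mu> z'"
proof (rule ccontr)
  obtain t x t' x' where z: "z = (t, x)" "z' = (t', x')"
    by (cases z, cases z') auto
  define m m' where "m = \<mu> z" and "m' = \<mu> z'"
  assume "\<mu> z \<noteq> \<mu> z'"
  then have "m - m' \<noteq> 0"
    by (simp add: m_def m'_def)
  \<comment> \<open>The time at which the lines of slopes \<open>m\<close> and \<open>m'\<close>
    through the two points meet.\<close>
  define \<tau> where "\<tau> = (x' - m' * t' - x + m * t) / (m - m')"
  have "x + m * (\<tau> - t) = x' + m' * (\<tau> - t')"
  proof -
    have "\<tau> * (m - m') = x' - m' * t' - x + m * t"
      using \<open>m - m' \<noteq> 0\<close> by (simp add: \<tau>_def)
    then show ?thesis
      by (simp add: algebra_simps)
  qed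
  moreover have "\<mu> (\<tau>, x + m * (\<tau> - t)) = m"
    using mu_const_on_line[of t "\<tau> - t" x] by (simp add: m_def z)
  moreover have "\<mu> (\<tau>, x' + m' * (\<tau> - t')) = m'"
    using mu_const_on_line[of t' "\<tau> - t'" x'] by (simp add: m'_def z)
  ultimately show False
    using \<open>m - m' \<noteq> 0\<close> by simp
qed

text \<open>
  Where \<open>(u\<^sub>1)\<^sub>x \<noteq> 0\<close>, repeated differentiation of \<open>Fx_eq\<close> in \<open>p\<close> at \<open>p = \<mu>\<close> and in \<open>x\<close>
  makes all odd \<open>p\<close>-derivatives of \<open>F\<close> at \<open>\<mu>\<close> vanish. Since \<open>n\<close> is odd and \<open>F\<close> has no term
  \<open>p\<^sup>n\<close>, the \<open>n\<close>-th one is a nonzero multiple of \<open>\<mu>\<close>.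
\<close>

lemma partial_x_u1_eq_0:
  assumes "\<mu> z \<noteq> 0"
  shows "partial_x (u 1) z = 0"
proof (rule ccontr)
  assume a: "partial_x (u 1) z \<noteq> 0"
  obtain t x where z: "z = (t, x)"
    by (cases z)
  define m where "m = \<mu> z"
  have m: "\<mu> z' = m" for z'
    unfolding m_def by (rule mu_constant)
  \<comment> \<open>Working on an open set lets the induction hypothesis hold for all nearby
    \<open>y\<close>, so that it can be differentiated in \<open>x\<close>.\<close>
  define S where "S = {y. partial_x (u 1) (t, y) \<noteq> 0}"
  have "continuous_on UNIV (\<lambda>y. partial_x (u 1) (t, y))"
    using n by (intro continuous_on_compose2[OF C_1_continuous(3)[OF C1]] continuous_intros subset_UNIV) auto
  then have S: "open S" "x \<in> S"
    using a unfolding S_def z by (auto intro: open_Collect_neq)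
  have odd: "\<forall>y\<in>S. poly ((pderiv ^^ (2 * j + 1)) (F (t, y))) m = 0" for j
  proof (induction j)
    case 0
    show ?case
      using mu_root m by simp
  next
    case (Suc j)
    show ?case
    proof
      fix y assume y: "y \<in> S"
      \<comment> \<open>The root is the constant \<open>m\<close>, so its velocity is 0 and the
        derivative in \<open>x\<close> inherits the vanishing.\<close>
      have "poly ((pderiv ^^ (2 * j + 1)) (map_poly complex_of_real (Fx (t, y)))) (of_real m)
          = - 0 * poly (pderiv ((pderiv ^^ (2 * j + 1)) (map_poly complex_of_real (F (t, y))))) (of_real m)"
      proof (rule poly_family_derivative_along_root[OF
            has_coeff_derivative_higher_pderiv[OF has_coeff_derivative_x] has_vector_derivative_const])
        show "\<forall>\<^sub>F r in nhds y. poly ((pderiv ^^ (2 * j + 1)) (map_poly complex_of_real (F (t, r)))) (of_real m) = 0"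
          using eventually_nhds_in_open[OF S(1) y] Suc
          by (auto elim!: eventually_mono simp: higher_pderiv_map_poly_of_real poly_map_poly_of_real
              simp del: funpow.simps)
      qed
      then have "poly ((pderiv ^^ (2 * j + 1)) (Fx (t, y))) m = 0"
        by (simp add: higher_pderiv_map_poly_of_real poly_map_poly_of_real del: funpow.simps)
      moreover have "poly ((pderiv ^^ Suc (2 * j + 1)) ([:- m, 1:] * Fx (t, y))) m
          = of_nat (Suc (2 * j + 1)) * poly ((pderiv ^^ (2 * j + 1)) (Fx (t, y))) m"
        unfolding higher_pderiv_linear_mult poly_add poly_mult poly_smult by simp
      moreover have "(pderiv ^^ Suc (2 * j + 1)) ([:- m, 1:] * Fx (t, y))
          = Polynomial.smult (partial_x (u 1) (t, y)) ((pderiv ^^ (2 * Suc j + 1)) (F (t, y)))"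
      proof -
        have "2 * Suc j + 1 = Suc (Suc (2 * j + 1))"
          by simp
        then have "(pderiv ^^ (2 * Suc j + 1)) (F (t, y)) = (pderiv ^^ Suc (2 * j + 1)) (pderiv (F (t, y)))"
          by (simp only: funpow_Suc_right[of "Suc (2 * j + 1)"] comp_def)
        then show ?thesis
          using Fx_eq[of "(t, y)"] unfolding m by (simp only: higher_pderiv_smult)
      qed
      ultimately have "partial_x (u 1) (t, y) * poly ((pderiv ^^ (2 * Suc j + 1)) (F (t, y))) m = 0"
        by (simp only: poly_smult mult_zero_right)
      then show "poly ((pderiv ^^ (2 * Suc j + 1)) (F (t, y))) m = 0"
        using y unfolding S_def by (simp del: funpow.simps)
    qed
  qed
  define D where "D = (pderiv ^^ n) (F (t, x))"
  have coeff_D: "Polynomial.coeff D k = pochhammer (of_nat (Suc k)) n * Polynomial.coeff (F (t, x)) (k + n)" for k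
    unfolding D_def by (rule coeff_higher_pderiv)
  \<comment> \<open>\<open>F\<close> has degree \<open>n + 1\<close>, so its \<open>n\<close>-th
    derivative is linear; the constant term vanishes because \<open>F\<close> has no term of degree
    \<open>n\<close>.\<close>
  have "D = [:0, Polynomial.coeff D 1:]"
  proof (rule poly_eqI)
    fix k
    show "Polynomial.coeff D k = Polynomial.coeff [:0, Polynomial.coeff D 1:] k"
      unfolding coeff_D coeff_F_poly by (auto simp: coeff_pCons split: nat.split)
  qed
  then have "poly D m = Polynomial.coeff D 1 * m"
    by (metis add_0 mult.commute mult_zero_right poly_0 poly_pCons add.right_neutral)
  moreover have "Polynomial.coeff D 1 > 0"
    unfolding coeff_D coeff_F_poly by (simp add: pochhammer_pos)
  \<comment> \<open>Oddness of \<open>n\<close> enters here: the order \<open>n = 2 * l + 1\<close>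
    is among those covered by \<open>odd\<close>.\<close>
  moreover have "poly D m = 0"
    using odd[of l] S(2) unfolding D_def n by simp
  ultimately show False
    using assms m_def by simp
qed

lemma partial_t_eq_0:
  assumes "k \<in> {1..n}"
  shows "partial_t (u k) z = 0"
proof -
  have "Ft z = 0"
  \<comment> \<open>In \<open>Ft_eq\<close> one factor always vanishes: either
    \<open>\<mu> z\<close>, or \<open>Fx z\<close> because \<open>partial_x (u 1) z = 0\<close> in
    \<open>Fx_eq\<close>.\<close>
  proof (cases "\<mu> z = 0")
    case False
    have "[:- \<mu> z, 1:] * Fx z = 0"
      unfolding Fx_eq partial_x_u1_eq_0[OF False] by simp
    then have "Fx z = 0"
      by (simp del: mult_pCons_left)
    then show ?thesis
      by (simp add: Ft_eq)
  qed (simp add: Ft_eq)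
  then have "Polynomial.coeff (Ft z) (n - k) = 0"
    by simp
  then show ?thesis
    using assms by (simp add: coeff_Ft split: if_splits)
qed

lemma independent_of_t:
  assumes "k \<in> {1..n}"
  shows "u k (t, x) = u k (t', x)"
proof -
  have "((\<lambda>s. u k (s, x)) has_real_derivative 0) (at s)" for s
    using C_1_DERIV_line[OF C1[OF assms], of 0 1 x 0 s] partial_t_eq_0[OF assms] by simp
  then show ?thesis
    by (intro DERIV_isconst_all[of "\<lambda>s. u k (s, x)"]) blast
qed

end

theorem theorem1p1:
  fixes l n :: nat
    and u :: "nat \<Rightarrow> real \<times> real \<Rightarrow> real"
    and \<mu> :: "real \<times> real \<Rightarrow> real"
    and lam :: "nat \<Rightarrow> real \<times> real \<Rightarrow> complex"
  assumes n: "n = 2 * l + 1"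
    and C2: "\<And>k. k \<in> {1..n} \<Longrightarrow> C_k 2 (u k)"
    and periodic: "periodic_t n u" "periodic_x n u"
    and system: "solves_system n u"
    and eigenvalues: "\<And>z. one_real_rest_conjugate_pairs l (sys_mat n (\<lambda>k. u k z))"
    and mu_cont: "continuous_on UNIV \<mu>"
    and lam_cont: "\<And>i. i \<in> {1..l} \<Longrightarrow> continuous_on UNIV (lam i)"
    and lam_nonreal: "\<And>i z. i \<in> {1..l} \<Longrightarrow> lam i z \<notin> \<real>"
    and factorization: "\<And>z. map_poly complex_of_real (pderiv (F_poly n (\<lambda>k. u k z))) =
      [:- complex_of_real (\<mu> z), 1:] * (\<Prod>i = 1..l. [:- lam i z, 1:] * [:- cnj (lam i z), 1:])"
  shows "\<forall>k\<in>{1..n}. \<forall>t t' x. u k (t, x) = u k (t', x)"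
proof -
  have C1: "C_k 1 (u k)" if "k \<in> {1..n}" for k
    using C2[OF that] by (auto simp: numeral_2_eq_2 intro: differentiable_imp_continuous_on)
  interpret factorized_system l n u \<mu> lam
    by unfold_locales (fact n C1 periodic system mu_cont lam_cont lam_nonreal factorization)+
  show ?thesis
    using independent_of_t by blast
qed

end
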